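(* Let $c,d\geq 1$ be integers and let $\xi\in\mathbb{F}_q\setminus\{0,1\}$. Then \[ a^{(1^{c+d})_{t-\xi}}_{(1^c)_{t-\xi}\,(1^d)_{t-\xi}}=q^{cd}\begin{bmatrix} c+d\\ c\end{bmatrix}_q , \] where $\begin{bmatrix} m\\ b\end{bmatrix}_q=\frac{[m][m-1]\cdots[m-b+1]}{[b]!}$ is the $q$-binomial coefficient, with $[m]=\frac{q^m-1}{q-1}$ and $[b]!=[b][b-1]\cdots[1]$.
   Context: Let $G_n=GL_n(q)$ over the finite field $\mathbb{F}_q$, with $G_n\subset G_{n+1}$ via $g\mapsto \mathrm{diag}(g,1)$ and $G_\infty=\bigcup_n G_n$. Let $\Phi$ be the set of monic irreducible polynomials in $\mathbb{F}_q[t]$ other than $t$, and $\mathcal{P}(\Phi)$ the set of partition-valued functions $\boldsymbol{\lambda}$ on $\Phi$ with finitely many nonempty values; set $\|\boldsymbol{\lambda}\|=\sum_f \deg(f)\,|\boldsymbol{\lambda}(f)|$. Conjugacy classes of $G_n$ correspond to types $\boldsymbol{\lambda}$ with $\|\boldsymbol{\lambda}\|=n$ (via the $\mathbb{F}_q[t]$-module $\bigoplus_{f,i}\mathbb{F}_q[t]/(f)^{\boldsymbol{\lambda}_i(f)}$). The modified type of an element of type $\boldsymbol{\lambda}$ is obtained by subtracting $1$ from each part of $\boldsymbol{\lambda}(t-1)$ (keeping the other $\boldsymbol{\lambda}(f)$); elements of $G_\infty$ are conjugate iff they have the same modified type. For a modified type $\boldsymbol{\mu}$, let $K_{\boldsymbol{\mu}}(n)$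 be the sum of elements of $G_n$ of modified type $\boldsymbol{\mu}$ (zero if $\|\boldsymbol{\mu}\|+\ell(\boldsymbol{\mu}(t-1))>n$); these form a basis of the center of $\mathbb{Z}[G_n]$, and one writes $K_{\boldsymbol{\lambda}}(n)K_{\boldsymbol{\mu}}(n)=\sum_{\boldsymbol{\nu}} a^{\boldsymbol{\nu}}_{\boldsymbol{\lambda}\boldsymbol{\mu}}(n)K_{\boldsymbol{\nu}}(n)$. When $\|\boldsymbol{\nu}\|=\|\boldsymbol{\lambda}\|+\|\boldsymbol{\mu}\|$, $a^{\boldsymbol{\nu}}_{\boldsymbol{\lambda}\boldsymbol{\mu}}(n)$ is independent of $n$ and is denoted $a^{\boldsymbol{\nu}}_{\boldsymbol{\lambda}\boldsymbol{\mu}}$. For $f\in\Phi$ and a partition $\lambda$, $(\lambda)_f\in\mathcal{P}(\Phi)$ denotes the function with value $\lambda$ at $f$ and $\emptyset$ elsewhere; thus $(1^c)_{t-\xi}$ is the modified type of $\mathrm{diag}(\xi,\dots,\xi,1,\dots)$ with $c$ entries $\xi$. *)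

theory Defs
  imports Complex_Main "Jordan_Normal_Form.Matrix"
begin

text \<open>The general linear group GL_n(F) over a finite field F (the type 'a), as the set of
  invertible n x n matrices.\<close>
definition GL :: "nat \<Rightarrow> ('a::field) mat set" where
  "GL n = {A \<in> carrier_mat n n. invertible_mat A}"

text \<open>The element diag(xi,...,xi,1,...,1) of GL_n with c entries xi; its modified type is
  (1^c)_{t-xi} (for n >= c).\<close>
definition diag_xi :: "nat \<Rightarrow> nat \<Rightarrow> 'a::field \<Rightarrow> 'a mat" where
  "diag_xi n c xi = mat n n (\<lambda>(i,j). if i = j then (if i < c then xi else 1) else 0)"

text \<open>Conjugacy class in GL_n of a matrix A.\<close>
definition conj_class :: "nat \<Rightarrow> ('a::field) mat \<Rightarrow> 'a mat set" where
  "conj_class n A = {B \<in> GL n. similar_mat B A}"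

text \<open>Elements of the integral group algebra Z[GL_n] are functions GL_n -> Z;
  the class sum K of a class C is its indicator function.\<close>
definition class_sum :: "('a::field) mat set \<Rightarrow> 'a mat \<Rightarrow> int" where
  "class_sum C = (\<lambda>x. if x \<in> C then 1 else 0)"

text \<open>Product in the group algebra Z[GL_n] (convolution).\<close>
definition galg_mult :: "nat \<Rightarrow> (('a::{field,finite}) mat \<Rightarrow> int) \<Rightarrow> ('a mat \<Rightarrow> int) \<Rightarrow> 'a mat \<Rightarrow> int" where
  "galg_mult n f g = (\<lambda>z. \<Sum>p \<in> {(x,y). x \<in> GL n \<and> y \<in> GL n \<and> x * y = z}. f (fst p) * g (snd p))"

text \<open>Structure constant a^nu_{lambda mu}(n): the coefficient of the class sum K_nu(n) in
  K_lambda(n) K_mu(n), where the classes are given by representatives.  Since the product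
  of class sums is a Z-combination of class sums, this coefficient is the value of the
  product at any element of the class nu, e.g. at its representative.\<close>
definition struct_const :: "nat \<Rightarrow> ('a::{field,finite}) mat \<Rightarrow> 'a mat \<Rightarrow> 'a mat \<Rightarrow> int" where
  "struct_const n L M N =
     galg_mult n (class_sum (conj_class n L)) (class_sum (conj_class n M)) N"

text \<open>q-numbers, q-factorials, q-binomials, as in the paper.\<close>
definition qnum :: "real \<Rightarrow> nat \<Rightarrow> real" where
  "qnum q m = (q ^ m - 1) / (q - 1)"

definition qfact :: "real \<Rightarrow> nat \<Rightarrow> real" where
  "qfact q b = (\<Prod>i\<in>{1..b}. qnum q i)"

definition qbinom :: "real \<Rightarrow> nat \<Rightarrow> nat \<Rightarrow> real" where
  "qbinom q m b = (\<Prod>i<b. qnum q (m - i)) / qfact q b"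

end

(*
  Over F_q, a matrix is conjugate to diag(xi,...,xi,1,...,1) with c entries xi exactly when its
  eigenspaces for xi and 1 have q^c and q^(n-c) elements: bases of the two eigenspaces are then
  independent and together form an invertible matrix conjugating it to the diagonal one.

  Let x y = diag_xi n (c + d) xi with x, y in the classes of types (1^c) and (1^d). The fixed
  spaces of x and y have q^(n-c) and q^(n-d) elements, and the counting form
  |A| |B| <= q^n |A intersect B| of the dimension formula forces their intersection to be the
  whole fixed space of the product, which has q^(n-c-d) elements. Hence x fixes the last
  n - c - d unit vectors; the same argument for the transposed factorization shows that so does
  the transpose of x, i.e. x = diag(w, 1) with w in GL_(c+d). Comparing eigenspaces, w lies in
  the class of diag_xi (c + d) c xi. Conversely every such w gives the factorization
  diag(w, 1) diag(xi w^-1, 1), as passing to xi w^-1 swaps the eigenspaces for xi and 1.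
  Since y is determined by x, the structure constant is the size of the class of
  diag_xi (c + d) c xi in GL_(c+d). Its centralizer consists of the block diagonal matrices, so
  this size is |GL_(c+d)| / (|GL_c| |GL_d|) = q^(cd) [c+d, c]_q.
*)
theory Submission
  imports Defs "Jordan_Normal_Form.Determinant"
begin

section \<open>Vectors and matrices over a finite field\<close>

lemma card_vec_box:
  "card {v \<in> carrier_vec n. \<forall>i<n. v $ i \<in> S i} = (\<Prod>i<n. card (S i))"
proof -
  have "bij_betw (\<lambda>v. \<lambda>i\<in>{..<n}. v $ i) {v \<in> carrier_vec n. \<forall>i<n. v $ i \<in> S i} (PiE {..<n} S)"
    by (rule bij_betwI[where g = "vec n"]) (auto simp: PiE_def extensional_def fun_eq_iff)
  then show ?thesis
    by (simp add: bij_betw_same_card card_PiE)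
qed

lemma card_carrier_vec: "card (carrier_vec n :: 'a::finite vec set) = card (UNIV :: 'a set) ^ n"
  using card_vec_box[of n "\<lambda>_. UNIV :: 'a set"] by simp

lemma finite_carrier_vec [simp]: "finite (carrier_vec n :: 'a::finite vec set)"
  by (rule card_ge_0_finite) (simp add: card_carrier_vec finite_UNIV_card_ge_0)

lemma finite_carrier_mat [simp]: "finite (carrier_mat n m :: 'a::finite mat set)"
proof (rule finite_subset)
  show "(carrier_mat n m :: 'a mat set) \<subseteq> mat_of_rows m ` {vs. set vs \<subseteq> carrier_vec m \<and> length vs = n}"
  proof
    fix A :: "'a mat" assume "A \<in> carrier_mat n m"
    then show "A \<in> mat_of_rows m ` {vs. set vs \<subseteq> carrier_vec m \<and> length vs = n}"
      by (intro image_eqI[where x = "rows A"]) (auto simp: set_rows_carrier)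
  qed
  show "finite (mat_of_rows m ` {vs. set vs \<subseteq> (carrier_vec m :: 'a vec set) \<and> length vs = n})"
    by (simp add: finite_lists_length_eq)
qed

lemma card_UNIV_field_ge_2: "2 \<le> card (UNIV :: 'a::{field,finite} set)"
proof -
  have "card {0, 1 :: 'a} \<le> card (UNIV :: 'a set)"
    by (rule card_mono) auto
  then show ?thesis
    by simp
qed

lemma inj_on_mult_mat_vec_iff:
  fixes M :: "'a::field mat"
  assumes M: "M \<in> carrier_mat m k"
  shows "inj_on ((*\<^sub>v) M) (carrier_vec k) \<longleftrightarrow> (\<forall>x\<in>carrier_vec k. M *\<^sub>v x = 0\<^sub>v m \<longrightarrow> x = 0\<^sub>v k)"
proof
  assume "inj_on ((*\<^sub>v) M) (carrier_vec k)"
  moreover have "M *\<^sub>v 0\<^sub>v k = 0\<^sub>v m"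
    using M by auto
  ultimately show "\<forall>x\<in>carrier_vec k. M *\<^sub>v x = 0\<^sub>v m \<longrightarrow> x = 0\<^sub>v k"
    by (metis inj_onD zero_carrier_vec)
next
  assume ker: "\<forall>x\<in>carrier_vec k. M *\<^sub>v x = 0\<^sub>v m \<longrightarrow> x = 0\<^sub>v k"
  show "inj_on ((*\<^sub>v) M) (carrier_vec k)"
  proof (rule inj_onI)
    fix x y assume x: "x \<in> carrier_vec k" and y: "y \<in> carrier_vec k" and "M *\<^sub>v x = M *\<^sub>v y"
    then have "M *\<^sub>v (x - y) = 0\<^sub>v m"
      using M by (simp add: mult_minus_distrib_mat_vec)
    then have "x - y = 0\<^sub>v k"
      using ker x y by simp
    then show "x = y"
      using x y by (auto simp: vec_eq_iff)
  qed
qed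

lemma GL_iff_det: "A \<in> GL m \<longleftrightarrow> A \<in> carrier_mat m m \<and> det A \<noteq> 0"
proof
  assume "A \<in> GL m"
  then obtain B where A: "A \<in> carrier_mat m m" and AB: "A * B = 1\<^sub>m m" and BA: "B * A = 1\<^sub>m (dim_row B)"
    unfolding GL_def invertible_mat_def inverts_mat_def by auto
  have B: "B \<in> carrier_mat m m"
    using arg_cong[OF AB, of dim_col] arg_cong[OF BA, of dim_col] A by auto
  have "det A * det B = 1"
    using det_mult[OF A B] AB by simp
  then show "A \<in> carrier_mat m m \<and> det A \<noteq> 0"
    using A by auto
next
  assume "A \<in> carrier_mat m m \<and> det A \<noteq> 0"
  then show "A \<in> GL m"
    using det_non_zero_imp_unit[of A m "()"]
    unfolding GL_def invertible_mat_def inverts_mat_def Units_def ring_mat_def by auto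
qed

lemma GL_carrier: "A \<in> GL m \<Longrightarrow> A \<in> carrier_mat m m"
  by (simp add: GL_iff_det)

lemma finite_GL [simp]: "finite (GL m :: 'a::{field,finite} mat set)"
  by (rule finite_subset[OF _ finite_carrier_mat]) (auto intro: GL_carrier)

lemma GL_inverseE:
  assumes "A \<in> GL m"
  obtains B where "B \<in> carrier_mat m m" "A * B = 1\<^sub>m m" "B * A = 1\<^sub>m m"
  using assms det_non_zero_imp_unit[of A m "()"] that
  unfolding GL_iff_det Units_def ring_mat_def by auto

lemma GL_mult: "A \<in> GL m \<Longrightarrow> B \<in> GL m \<Longrightarrow> A * B \<in> GL m"
  by (auto simp: GL_iff_det det_mult)

lemma GL_if_mult_eq_one:
  assumes "A \<in> carrier_mat m m" "B \<in> carrier_mat m m" "A * B = 1\<^sub>m m"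
  shows "A \<in> GL m" "B \<in> GL m"
proof -
  have "det A * det B = 1"
    using det_mult[OF assms(1,2)] assms(3) by simp
  then show "A \<in> GL m" "B \<in> GL m"
    using assms by (auto simp: GL_iff_det)
qed

lemma GL_iff_inj: "A \<in> GL m \<longleftrightarrow> A \<in> carrier_mat m m \<and> inj_on ((*\<^sub>v) A) (carrier_vec m)"
proof (cases "A \<in> carrier_mat m m")
  case True
  then show ?thesis
    unfolding GL_iff_det det_0_iff_vec_prod_zero_field[OF True] inj_on_mult_mat_vec_iff[OF True]
    by auto
qed (simp add: GL_iff_det)

lemma mult_cancel_left_mat:
  fixes Q P X :: "'a::semiring_1 mat"
  assumes "Q \<in> carrier_mat m m" "P \<in> carrier_mat m m" "Q * P = 1\<^sub>m m" "X \<in> carrier_mat m k"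
  shows "Q * (P * X) = X"
  using assms assoc_mult_mat[of Q m m P m X k] left_mult_one_mat[OF assms(4)] by simp

section \<open>Subspaces and matrices with independent columns\<close>

definition vec_subspace :: "nat \<Rightarrow> 'a::field vec set \<Rightarrow> bool" where
  "vec_subspace m V \<longleftrightarrow> V \<subseteq> carrier_vec m \<and> 0\<^sub>v m \<in> V \<and> (\<forall>u\<in>V. \<forall>w\<in>V. u + w \<in> V)
     \<and> (\<forall>a. \<forall>u\<in>V. a \<cdot>\<^sub>v u \<in> V)"

lemma vec_subspace_diff:
  assumes V: "vec_subspace m V" and "u \<in> V" "w \<in> V"
  shows "u - w \<in> V"
proof -
  have "u + (-1) \<cdot>\<^sub>v w \<in> V"
    using assms unfolding vec_subspace_def by blast
  moreover have "u + (-1) \<cdot>\<^sub>v w = u - w"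
    using assms unfolding vec_subspace_def by (intro eq_vecI) auto
  ultimately show ?thesis
    by simp
qed

lemma inj_on_sum_diff:
  fixes r :: "'a::ab_group_add vec \<Rightarrow> 'a vec"
  assumes "A \<subseteq> carrier_vec m" "B \<subseteq> carrier_vec m" "\<And>a b. a \<in> A \<Longrightarrow> b \<in> B \<Longrightarrow> r (a + b) \<in> carrier_vec m"
  shows "inj_on (\<lambda>(a, b). (a + b, a - r (a + b))) (A \<times> B)"
proof (rule inj_onI, clarify)
  fix a b a' b' assume ab: "a \<in> A" "b \<in> B" "a' \<in> A" "b' \<in> B"
    and s: "a + b = a' + b'" and d: "a - r (a + b) = a' - r (a' + b')"
  have c: "a \<in> carrier_vec m" "b \<in> carrier_vec m" "a' \<in> carrier_vec m" "b' \<in> carrier_vec m"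
    "r (a + b) \<in> carrier_vec m"
    using ab assms by auto
  have d': "a - r (a + b) = a' - r (a + b)"
    using d s by simp
  have "a $ i = a' $ i \<and> b $ i = b' $ i" if "i < m" for i
    using arg_cong[OF s, of "\<lambda>v. v $ i"] arg_cong[OF d', of "\<lambda>v. v $ i"] that c by simp
  then show "a = a' \<and> b = b'"
    using c by (auto intro!: eq_vecI)
qed

text \<open>Choosing for every element \<open>s\<close> of \<open>A + B\<close> one decomposition \<open>s = r s + (s - r s)\<close>,
  the map \<open>(a, b) \<mapsto> (a + b, a - r (a + b))\<close> embeds \<open>A \<times> B\<close> into \<open>F\<^sup>m \<times> (A \<inter> B)\<close>.\<close>
lemma card_vec_subspace_inter:
  fixes A B :: "'a::{field,finite} vec set"
  assumes SA: "vec_subspace m A" and SB: "vec_subspace m B"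
  shows "card A * card B \<le> card (UNIV :: 'a set) ^ m * card (A \<inter> B)"
proof -
  have Ac: "A \<subseteq> carrier_vec m" and Bc: "B \<subseteq> carrier_vec m"
    using SA SB unfolding vec_subspace_def by auto
  define r where "r s = (SOME a. a \<in> A \<and> s - a \<in> B)" for s
  have r: "r (a + b) \<in> A" "a + b - r (a + b) \<in> B" if "a \<in> A" "b \<in> B" for a b
  proof -
    have "a \<in> carrier_vec m" "b \<in> carrier_vec m"
      using that Ac Bc by auto
    then have "a + b - a = b"
      by (intro eq_vecI) auto
    then have "a \<in> A \<and> a + b - a \<in> B"
      using that by simp
    then show "r (a + b) \<in> A" "a + b - r (a + b) \<in> B"
      unfolding r_def by (metis (mono_tags, lifting) someI)+
  qed
  have "(a + b, a - r (a + b)) \<in> carrier_vec m \<times> (A \<inter> B)" if ab: "a \<in> A" "b \<in> B" for a b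
  proof -
    have ac: "a \<in> carrier_vec m" "b \<in> carrier_vec m" "r (a + b) \<in> carrier_vec m"
      using r ab Ac Bc by auto
    have "a - r (a + b) = (a + b - r (a + b)) - b"
      using ac by (intro eq_vecI) auto
    then show ?thesis
      using vec_subspace_diff[OF SA ab(1) r(1)[OF ab]] vec_subspace_diff[OF SB r(2)[OF ab] ab(2)] ac by simp
  qed
  then have "(\<lambda>(a, b). (a + b, a - r (a + b))) ` (A \<times> B) \<subseteq> carrier_vec m \<times> (A \<inter> B)"
    by auto
  moreover have "finite (carrier_vec m \<times> (A \<inter> B) :: ('a vec \<times> 'a vec) set)"
    using finite_subset[OF _ finite_carrier_vec] Ac by auto
  moreover have "inj_on (\<lambda>(a, b). (a + b, a - r (a + b))) (A \<times> B)"
    by (rule inj_on_sum_diff[OF Ac Bc]) (use r Ac in blast)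
  ultimately have "card (A \<times> B) \<le> card ((carrier_vec m :: 'a vec set) \<times> (A \<inter> B))"
    using card_inj_on_le by blast
  then show ?thesis
    by (simp add: card_cartesian_product card_carrier_vec)
qed

definition injective_mats :: "nat \<Rightarrow> nat \<Rightarrow> 'a::field mat set" where
  "injective_mats m k = {M \<in> carrier_mat m k. inj_on ((*\<^sub>v) M) (carrier_vec k)}"

definition append_cols :: "'a mat \<Rightarrow> 'a mat \<Rightarrow> 'a mat" where
  "append_cols M1 M2 = mat (dim_row M1) (dim_col M1 + dim_col M2)
     (\<lambda>(i, j). if j < dim_col M1 then M1 $$ (i, j) else M2 $$ (i, j - dim_col M1))"

definition col_mat :: "'a vec \<Rightarrow> 'a mat" where
  "col_mat v = mat (dim_vec v) 1 (\<lambda>(i, _). v $ i)"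

lemma dim_append_cols [simp]:
  "dim_row (append_cols M1 M2) = dim_row M1" "dim_col (append_cols M1 M2) = dim_col M1 + dim_col M2"
  unfolding append_cols_def by auto

lemma append_cols_carrier [simp]:
  "M1 \<in> carrier_mat m k1 \<Longrightarrow> M2 \<in> carrier_mat m k2 \<Longrightarrow> append_cols M1 M2 \<in> carrier_mat m (k1 + k2)"
  unfolding append_cols_def by auto

lemma col_mat_carrier [simp]: "v \<in> carrier_vec m \<Longrightarrow> col_mat v \<in> carrier_mat m 1"
  unfolding col_mat_def by auto

lemma append_cols_mult_vec:
  assumes "M1 \<in> carrier_mat m k1" "M2 \<in> carrier_mat m k2" "a \<in> carrier_vec k1" "b \<in> carrier_vec k2"
  shows "append_cols M1 M2 *\<^sub>v (a @\<^sub>v b) = M1 *\<^sub>v a + M2 *\<^sub>v b"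
proof -
  have "row (append_cols M1 M2) i = row M1 i @\<^sub>v row M2 i" if "i < m" for i
    using assms that by (intro eq_vecI) (auto simp: append_cols_def)
  then show ?thesis
    using assms by (intro eq_vecI) (auto simp: scalar_prod_append[of _ k1 _ k2])
qed

lemma col_mat_mult_vec:
  fixes v :: "'a::comm_semiring_1 vec"
  assumes "b \<in> carrier_vec 1"
  shows "col_mat v *\<^sub>v b = b $ 0 \<cdot>\<^sub>v v"
  using assms by (intro eq_vecI) (auto simp: col_mat_def scalar_prod_def mult.commute)

lemma injective_mats_carrier: "M \<in> injective_mats m k \<Longrightarrow> M \<in> carrier_mat m k"
  unfolding injective_mats_def by simp

lemma injective_matsI:
  assumes "M \<in> carrier_mat m k" "\<And>x. x \<in> carrier_vec k \<Longrightarrow> M *\<^sub>v x = 0\<^sub>v m \<Longrightarrow> x = 0\<^sub>v k"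
  shows "M \<in> injective_mats m k"
  using assms by (simp add: injective_mats_def inj_on_mult_mat_vec_iff)

lemma injective_matsD:
  "M \<in> injective_mats m k \<Longrightarrow> x \<in> carrier_vec k \<Longrightarrow> M *\<^sub>v x = 0\<^sub>v m \<Longrightarrow> x = 0\<^sub>v k"
  unfolding injective_mats_def using inj_on_mult_mat_vec_iff by auto

lemma append_cols_injective:
  assumes M1: "M1 \<in> injective_mats m k1" and M2: "M2 \<in> injective_mats m k2"
    and disjoint: "(*\<^sub>v) M1 ` carrier_vec k1 \<inter> (*\<^sub>v) M2 ` carrier_vec k2 \<subseteq> {0\<^sub>v m}"
  shows "append_cols M1 M2 \<in> injective_mats m (k1 + k2)"
proof (rule injective_matsI)
  have M1c: "M1 \<in> carrier_mat m k1" and M2c: "M2 \<in> carrier_mat m k2"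
    using M1 M2 by (auto simp: injective_mats_carrier)
  then show "append_cols M1 M2 \<in> carrier_mat m (k1 + k2)"
    by simp
  fix x :: "'a vec" assume x: "x \<in> carrier_vec (k1 + k2)" and "append_cols M1 M2 *\<^sub>v x = 0\<^sub>v m"
  define a b where "a = vec_first x k1" and "b = vec_last x k2"
  have ab: "a \<in> carrier_vec k1" "b \<in> carrier_vec k2" "x = a @\<^sub>v b"
    using x by (auto simp: a_def b_def)
  then have sum0: "M1 *\<^sub>v a + M2 *\<^sub>v b = 0\<^sub>v m"
    using \<open>append_cols M1 M2 *\<^sub>v x = 0\<^sub>v m\<close> append_cols_mult_vec[OF M1c M2c] by simp
  have "(M1 *\<^sub>v a) $ i = (M2 *\<^sub>v ((-1) \<cdot>\<^sub>v b)) $ i" if "i < m" for i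
    using arg_cong[OF sum0, of "\<lambda>v. v $ i"] that M1c M2c ab by (simp add: mult_mat_vec eq_neg_iff_add_eq_0)
  then have "M1 *\<^sub>v a = M2 *\<^sub>v ((-1) \<cdot>\<^sub>v b)"
    using M1c M2c by (intro eq_vecI) auto
  then have "M1 *\<^sub>v a \<in> (*\<^sub>v) M1 ` carrier_vec k1 \<inter> (*\<^sub>v) M2 ` carrier_vec k2"
    using ab by (metis IntI image_eqI smult_carrier_vec)
  then have "M1 *\<^sub>v a = 0\<^sub>v m"
    using disjoint by auto
  moreover from this have "M2 *\<^sub>v b = 0\<^sub>v m"
    using sum0 M2c ab by simp
  ultimately have "a = 0\<^sub>v k1" "b = 0\<^sub>v k2"
    using M1 M2 ab by (auto intro: injective_matsD)
  then show "x = 0\<^sub>v (k1 + k2)"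
    using ab by (auto intro!: eq_vecI)
qed

lemma card_image_injective_mat:
  fixes M :: "'a::{field,finite} mat"
  assumes "M \<in> injective_mats m k"
  shows "card ((*\<^sub>v) M ` carrier_vec k) = card (UNIV :: 'a set) ^ k"
  using assms unfolding injective_mats_def by (simp add: card_image card_carrier_vec)

lemma injective_mats_le:
  fixes M :: "'a::{field,finite} mat"
  assumes "M \<in> injective_mats m k"
  shows "k \<le> m"
proof -
  have "card ((*\<^sub>v) M ` carrier_vec k) \<le> card (carrier_vec m :: 'a vec set)"
    using injective_mats_carrier[OF assms] by (intro card_mono) auto
  then show ?thesis
    using card_image_injective_mat[OF assms] card_UNIV_field_ge_2[where 'a = 'a]
    by (simp add: card_carrier_vec power_increasing_iff)
qed

lemma injective_mats_0: "injective_mats m 0 = {0\<^sub>m m 0}"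
  unfolding injective_mats_def by (auto simp: inj_on_def intro!: eq_matI eq_vecI)

lemma col_mat_injective:
  assumes v: "v \<in> carrier_vec m" "v \<noteq> 0\<^sub>v m"
  shows "col_mat v \<in> injective_mats m 1"
proof (rule injective_matsI)
  obtain i where i: "i < m" "v $ i \<noteq> 0"
    using v by (auto simp: vec_eq_iff)
  fix b :: "'a vec" assume b: "b \<in> carrier_vec 1" and "col_mat v *\<^sub>v b = 0\<^sub>v m"
  then have "b $ 0 * v $ i = 0"
    using i v(1) col_mat_mult_vec[OF b, of v] by (metis index_smult_vec(1) index_zero_vec(1) carrier_vecD)
  then show "b = 0\<^sub>v 1"
    using b i by (auto intro!: eq_vecI)
qed (use v in \<open>simp add: col_mat_def\<close>)

lemma append_col_mat_injective:
  assumes M: "M \<in> injective_mats m k" and v: "v \<in> carrier_vec m" "v \<notin> (*\<^sub>v) M ` carrier_vec k"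
  shows "append_cols M (col_mat v) \<in> injective_mats m (Suc k)"
proof -
  have Mc: "M \<in> carrier_mat m k"
    using M by (rule injective_mats_carrier)
  have "M *\<^sub>v 0\<^sub>v k = 0\<^sub>v m"
    using Mc by auto
  then have "v \<noteq> 0\<^sub>v m"
    using v(2) by (metis image_eqI zero_carrier_vec)
  moreover have "(*\<^sub>v) M ` carrier_vec k \<inter> (*\<^sub>v) (col_mat v) ` carrier_vec 1 \<subseteq> {0\<^sub>v m}"
  proof clarify
    fix a b :: "'a vec" assume a: "a \<in> carrier_vec k" and b: "b \<in> carrier_vec 1"
      and eq: "M *\<^sub>v a = col_mat v *\<^sub>v b"
    then have eq': "M *\<^sub>v a = b $ 0 \<cdot>\<^sub>v v"
      by (simp add: col_mat_mult_vec)
    have "b $ 0 = 0"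
    proof (rule ccontr)
      assume "b $ 0 \<noteq> 0"
      then have "M *\<^sub>v (inverse (b $ 0) \<cdot>\<^sub>v a) = v"
        using eq' Mc a v(1) by (simp add: mult_mat_vec smult_smult_assoc)
      then show False
        using v(2) a by (metis image_eqI smult_carrier_vec)
    qed
    then show "M *\<^sub>v a = 0\<^sub>v m"
      using eq' v(1) by (auto intro!: eq_vecI)
  qed
  ultimately show ?thesis
    using append_cols_injective[OF M col_mat_injective[OF v(1)]] by simp
qed

lemma zero_smult_vec [simp]: "(v :: 'a::semiring_0 vec) \<in> carrier_vec n \<Longrightarrow> 0 \<cdot>\<^sub>v v = 0\<^sub>v n"
  by (intro eq_vecI) auto

lemma append_col_mat_injectiveD:
  assumes M': "append_cols M (col_mat v) \<in> injective_mats m (Suc k)"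
    and M: "M \<in> carrier_mat m k" and v: "v \<in> carrier_vec m"
  shows "M \<in> injective_mats m k" "v \<notin> (*\<^sub>v) M ` carrier_vec k"
proof -
  have mult: "append_cols M (col_mat v) *\<^sub>v (a @\<^sub>v vec 1 (\<lambda>_. t)) = M *\<^sub>v a + t \<cdot>\<^sub>v v"
    if "a \<in> carrier_vec k" for a t
    using append_cols_mult_vec[OF M col_mat_carrier[OF v] that] col_mat_mult_vec[of "vec 1 (\<lambda>_. t)" v]
    by simp
  show "M \<in> injective_mats m k"
  proof (rule injective_matsI[OF M])
    fix a assume a: "a \<in> carrier_vec k" and "M *\<^sub>v a = 0\<^sub>v m"
    then have "append_cols M (col_mat v) *\<^sub>v (a @\<^sub>v vec 1 (\<lambda>_. 0)) = 0\<^sub>v m"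
      using mult[OF a, of 0] M v by (simp add: zero_smult_vec)
    then have a0: "a @\<^sub>v vec 1 (\<lambda>_. 0) = 0\<^sub>v (Suc k)"
      using injective_matsD[OF M'] append_carrier_vec[OF a, of "vec 1 (\<lambda>_. 0)" 1] by simp
    have "a $ i = 0" if "i < k" for i
      using arg_cong[OF a0, of "\<lambda>x. x $ i"] a that by simp
    then show "a = 0\<^sub>v k"
      using a by (auto intro!: eq_vecI)
  qed
  show "v \<notin> (*\<^sub>v) M ` carrier_vec k"
  proof
    assume "v \<in> (*\<^sub>v) M ` carrier_vec k"
    then obtain u where u: "u \<in> carrier_vec k" "v = M *\<^sub>v u"
      by blast
    then have "append_cols M (col_mat v) *\<^sub>v (u @\<^sub>v vec 1 (\<lambda>_. -1)) = 0\<^sub>v m"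
      using mult[OF u(1), of "-1"] M v by (auto intro!: eq_vecI)
    then have u0: "u @\<^sub>v vec 1 (\<lambda>_. -1) = 0\<^sub>v (Suc k)"
      using injective_matsD[OF M'] append_carrier_vec[OF u(1), of "vec 1 (\<lambda>_. -1)" 1] by simp
    show False
      using arg_cong[OF u0, of "\<lambda>x. x $ k"] u by simp
  qed
qed

lemma append_cols_split_last_col:
  assumes "M' \<in> carrier_mat m (Suc k)"
  shows "append_cols (mat m k (\<lambda>(i, j). M' $$ (i, j))) (col_mat (col M' k)) = M'"
  using assms by (intro eq_matI) (auto simp: append_cols_def col_mat_def less_Suc_eq)

lemma bij_betw_append_col_mat:
  "bij_betw (\<lambda>(M, v). append_cols M (col_mat v))
     (SIGMA M:injective_mats m k. carrier_vec m - (*\<^sub>v) M ` carrier_vec k) (injective_mats m (Suc k))"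
  (is "bij_betw ?f ?S _")
proof (rule bij_betwI[where g = "\<lambda>M'. (mat m k (\<lambda>(i, j). M' $$ (i, j)), col M' k)"])
  show "?f \<in> ?S \<rightarrow> injective_mats m (Suc k)"
    using append_col_mat_injective by auto
  show "(\<lambda>M'. (mat m k (\<lambda>(i, j). M' $$ (i, j)), col M' k)) \<in> injective_mats m (Suc k) \<rightarrow> ?S"
  proof
    fix M' :: "'a mat" assume M': "M' \<in> injective_mats m (Suc k)"
    then have M'c: "M' \<in> carrier_mat m (Suc k)"
      by (rule injective_mats_carrier)
    then have "append_cols (mat m k (\<lambda>(i, j). M' $$ (i, j))) (col_mat (col M' k)) \<in> injective_mats m (Suc k)"
      using M' append_cols_split_last_col[OF M'c] by metis
    moreover have "mat m k (\<lambda>(i, j). M' $$ (i, j)) \<in> carrier_mat m k" "col M' k \<in> carrier_vec m"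
      using M'c by auto
    ultimately show "(mat m k (\<lambda>(i, j). M' $$ (i, j)), col M' k) \<in> ?S"
      using append_col_mat_injectiveD by blast
  qed
next
  fix p assume "p \<in> ?S"
  then obtain M v where p: "p = (M, v)" "M \<in> carrier_mat m k" "v \<in> carrier_vec m"
    by (auto dest: injective_mats_carrier)
  then have "mat m k (\<lambda>(i, j). append_cols M (col_mat v) $$ (i, j)) = M"
    by (intro eq_matI) (auto simp: append_cols_def)
  moreover have "col (append_cols M (col_mat v)) k = v"
    using p by (intro eq_vecI) (auto simp: append_cols_def col_mat_def)
  ultimately show "(mat m k (\<lambda>(i, j). ?f p $$ (i, j)), col (?f p) k) = p"
    using p by simp
next
  fix M' :: "'a mat" assume "M' \<in> injective_mats m (Suc k)"
  then show "?f (mat m k (\<lambda>(i, j). M' $$ (i, j)), col M' k) = M'"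
    using append_cols_split_last_col[OF injective_mats_carrier] by simp
qed

lemma card_injective_mats_Suc:
  "card (injective_mats m (Suc k) :: 'a::{field,finite} mat set)
     = card (injective_mats m k :: 'a mat set) * (card (UNIV :: 'a set) ^ m - card (UNIV :: 'a set) ^ k)"
proof -
  let ?S = "SIGMA M:(injective_mats m k :: 'a mat set). carrier_vec m - (*\<^sub>v) M ` carrier_vec k"
  have "card (injective_mats m (Suc k) :: 'a mat set) = card ?S"
    using bij_betw_append_col_mat by (metis bij_betw_same_card)
  also have "\<dots> = (\<Sum>M :: 'a mat\<in>injective_mats m k. card (carrier_vec m - (*\<^sub>v) M ` carrier_vec k))"
    by (subst card_SigmaI) (auto intro: finite_subset[OF _ finite_carrier_mat[of m k]] dest: injective_mats_carrier)
  also have "\<dots> = (\<Sum>M :: 'a mat\<in>injective_mats m k. card (UNIV :: 'a set) ^ m - card (UNIV :: 'a set) ^ k)"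
  proof (rule sum.cong[OF refl])
    fix M :: "'a mat" assume M: "M \<in> injective_mats m k"
    have "(*\<^sub>v) M ` carrier_vec k \<subseteq> carrier_vec m"
      using injective_mats_carrier[OF M] by auto
    then show "card (carrier_vec m - (*\<^sub>v) M ` carrier_vec k) = card (UNIV :: 'a set) ^ m - card (UNIV :: 'a set) ^ k"
      by (simp add: card_Diff_subset card_carrier_vec card_image_injective_mat[OF M])
  qed
  finally show ?thesis
    by simp
qed

lemma card_injective_mats:
  "card (injective_mats m k :: 'a::{field,finite} mat set)
     = (\<Prod>i<k. card (UNIV :: 'a set) ^ m - card (UNIV :: 'a set) ^ i)"
  by (induction k) (simp_all add: injective_mats_0 card_injective_mats_Suc)

lemma GL_eq_injective_mats: "GL m = injective_mats m m"
  unfolding injective_mats_def by (auto simp: GL_iff_inj)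

lemma card_GL:
  "card (GL m :: 'a::{field,finite} mat set) = (\<Prod>i<m. card (UNIV :: 'a set) ^ m - card (UNIV :: 'a set) ^ i)"
  by (simp add: GL_eq_injective_mats card_injective_mats)

lemma image_append_col_mat_subset:
  assumes V: "vec_subspace m V" and M: "M \<in> carrier_mat m k" and sub: "(*\<^sub>v) M ` carrier_vec k \<subseteq> V"
    and v: "v \<in> V"
  shows "(*\<^sub>v) (append_cols M (col_mat v)) ` carrier_vec (Suc k) \<subseteq> V"
proof clarify
  fix x :: "'a vec" assume "x \<in> carrier_vec (Suc k)"
  then have "append_cols M (col_mat v) *\<^sub>v x = M *\<^sub>v vec_first x k + vec_last x 1 $ 0 \<cdot>\<^sub>v v"
    using append_cols_mult_vec[OF M col_mat_carrier, of v "vec_first x k" "vec_last x 1"]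
      col_mat_mult_vec[of "vec_last x 1" v] V v unfolding vec_subspace_def by auto
  moreover have "M *\<^sub>v vec_first x k \<in> V" "vec_last x 1 $ 0 \<cdot>\<^sub>v v \<in> V"
    using sub v V unfolding vec_subspace_def by auto
  ultimately show "append_cols M (col_mat v) *\<^sub>v x \<in> V"
    using V unfolding vec_subspace_def by simp
qed

lemma vec_subspace_eq_image:
  fixes V :: "'a::{field,finite} vec set"
  assumes V: "vec_subspace m V"
  obtains k M where "M \<in> injective_mats m k" "(*\<^sub>v) M ` carrier_vec k = V"
proof -
  define P where "P k \<longleftrightarrow> (\<exists>M \<in> injective_mats m k. (*\<^sub>v) M ` carrier_vec k \<subseteq> V)" for k
  have "0\<^sub>m m 0 *\<^sub>v x = 0\<^sub>v m" if "x \<in> carrier_vec 0" for x :: "'a vec"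
    using that by (intro eq_vecI) (auto simp: scalar_prod_def)
  then have "P 0"
    using V unfolding P_def vec_subspace_def by (auto simp: injective_mats_0)
  moreover have "\<forall>k. P k \<longrightarrow> k \<le> m"
    unfolding P_def by (auto dest: injective_mats_le)
  ultimately obtain k where "P k" and max: "\<forall>k'. P k' \<longrightarrow> k' \<le> k"
    using Nat.ex_has_greatest_nat[where P = P and k = 0 and b = m] by auto
  then obtain M where M: "M \<in> injective_mats m k" and sub: "(*\<^sub>v) M ` carrier_vec k \<subseteq> V"
    unfolding P_def by blast
  have "(*\<^sub>v) M ` carrier_vec k = V"
  proof (rule ccontr)
    assume "(*\<^sub>v) M ` carrier_vec k \<noteq> V"
    then obtain v where v: "v \<in> V" "v \<notin> (*\<^sub>v) M ` carrier_vec k"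
      using sub by blast
    have "v \<in> carrier_vec m"
      using V v unfolding vec_subspace_def by auto
    then have "P (Suc k)"
      using append_col_mat_injective[OF M _ v(2)] image_append_col_mat_subset[OF V injective_mats_carrier[OF M] sub v(1)]
      unfolding P_def by blast
    then show False
      using max Suc_n_not_le_n by blast
  qed
  then show ?thesis
    using M that by blast
qed

section \<open>Diagonal matrices and eigenspaces\<close>

definition diag_fun_mat :: "nat \<Rightarrow> (nat \<Rightarrow> 'a::zero) \<Rightarrow> 'a mat" where
  "diag_fun_mat n f = mat n n (\<lambda>(i, j). if i = j then f i else 0)"

lemma diag_fun_mat_carrier [simp]: "diag_fun_mat n f \<in> carrier_mat n n"
  unfolding diag_fun_mat_def by simp

lemma dim_diag_fun_mat [simp]: "dim_row (diag_fun_mat n f) = n" "dim_col (diag_fun_mat n f) = n"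
  unfolding diag_fun_mat_def by simp_all

lemma diag_xi_eq_diag_fun_mat: "diag_xi n c xi = diag_fun_mat n (\<lambda>i. if i < c then xi else 1)"
  unfolding diag_xi_def diag_fun_mat_def by (intro eq_matI) auto

lemma diag_xi_carrier [simp]: "diag_xi n c xi \<in> carrier_mat n n"
  by (simp add: diag_xi_eq_diag_fun_mat)

lemma mult_diag_fun_mat_right:
  fixes A :: "'a::semiring_0 mat"
  assumes "A \<in> carrier_mat r n"
  shows "A * diag_fun_mat n f = mat r n (\<lambda>(i, j). A $$ (i, j) * f j)"
  using assms
  by (intro eq_matI) (auto simp: diag_fun_mat_def scalar_prod_def if_distrib if_distribR sum.delta sum.delta' cong: if_cong)

lemma mult_diag_fun_mat_left:
  fixes A :: "'a::semiring_0 mat"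
  assumes "A \<in> carrier_mat n r"
  shows "diag_fun_mat n f * A = mat n r (\<lambda>(i, j). f i * A $$ (i, j))"
  using assms
  by (intro eq_matI) (auto simp: diag_fun_mat_def scalar_prod_def if_distrib if_distribR sum.delta sum.delta' cong: if_cong)

lemma diag_fun_mat_mult_vec:
  fixes v :: "'a::semiring_0 vec"
  assumes "v \<in> carrier_vec n"
  shows "diag_fun_mat n f *\<^sub>v v = vec n (\<lambda>i. f i * v $ i)"
  using assms
  by (intro eq_vecI) (auto simp: diag_fun_mat_def scalar_prod_def if_distrib if_distribR sum.delta sum.delta' cong: if_cong)

lemma diag_fun_mat_mult: "diag_fun_mat n f * diag_fun_mat n g = diag_fun_mat n (\<lambda>i. f i * g i :: 'a::semiring_0)"
  by (subst mult_diag_fun_mat_right) (auto simp: diag_fun_mat_def intro!: eq_matI)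

lemma diag_fun_mat_GL:
  fixes f :: "nat \<Rightarrow> 'a::field"
  assumes "\<And>i. i < n \<Longrightarrow> f i \<noteq> 0"
  shows "diag_fun_mat n f \<in> GL n"
proof -
  have "diag_fun_mat n f * diag_fun_mat n (\<lambda>i. inverse (f i)) = diag_fun_mat n (\<lambda>i. f i * inverse (f i))"
    by (rule diag_fun_mat_mult)
  also have "\<dots> = 1\<^sub>m n"
    using assms by (auto simp: diag_fun_mat_def intro!: eq_matI)
  finally show ?thesis
    by (rule GL_if_mult_eq_one(1)[OF diag_fun_mat_carrier diag_fun_mat_carrier])
qed

lemma diag_xi_GL: "(xi :: 'a::field) \<noteq> 0 \<Longrightarrow> diag_xi n c xi \<in> GL n"
  unfolding diag_xi_eq_diag_fun_mat by (rule diag_fun_mat_GL) auto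

lemma diag_fun_mat_commute_iff:
  fixes P :: "'a::idom mat"
  assumes "P \<in> carrier_mat n n"
  shows "diag_fun_mat n f * P = P * diag_fun_mat n f \<longleftrightarrow> (\<forall>i<n. \<forall>j<n. f i \<noteq> f j \<longrightarrow> P $$ (i, j) = 0)"
proof -
  have entry: "f i * P $$ (i, j) = P $$ (i, j) * f j \<longleftrightarrow> (f i \<noteq> f j \<longrightarrow> P $$ (i, j) = 0)" for i j
    by (auto simp: mult.commute[of "P $$ (i, j)"])
  have "diag_fun_mat n f * P = P * diag_fun_mat n f \<longleftrightarrow> (\<forall>i<n. \<forall>j<n. f i * P $$ (i, j) = P $$ (i, j) * f j)"
    unfolding mult_diag_fun_mat_left[OF assms] mult_diag_fun_mat_right[OF assms] mat_eq_iff by simp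
  then show ?thesis
    by (simp only: entry)
qed

definition eigenspace :: "nat \<Rightarrow> 'a::field mat \<Rightarrow> 'a \<Rightarrow> 'a vec set" where
  "eigenspace n A \<mu> = {v \<in> carrier_vec n. A *\<^sub>v v = \<mu> \<cdot>\<^sub>v v}"

lemma eigenspace_carrier: "eigenspace n A \<mu> \<subseteq> carrier_vec n"
  unfolding eigenspace_def by auto

lemma finite_eigenspace [simp]: "finite (eigenspace n A (\<mu> :: 'a::{field,finite}))"
  using finite_subset[OF eigenspace_carrier finite_carrier_vec] .

lemma vec_subspace_eigenspace:
  assumes A: "A \<in> carrier_mat n n"
  shows "vec_subspace n (eigenspace n A \<mu>)"
  unfolding vec_subspace_def eigenspace_def
proof (intro conjI ballI allI)
  fix u w assume "u \<in> {v \<in> carrier_vec n. A *\<^sub>v v = \<mu> \<cdot>\<^sub>v v}" "w \<in> {v \<in> carrier_vec n. A *\<^sub>v v = \<mu> \<cdot>\<^sub>v v}"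
  then show "u + w \<in> {v \<in> carrier_vec n. A *\<^sub>v v = \<mu> \<cdot>\<^sub>v v}"
    using A by (auto simp: mult_add_distrib_mat_vec smult_add_distrib_vec[of _ n])
next
  fix a u assume "u \<in> {v \<in> carrier_vec n. A *\<^sub>v v = \<mu> \<cdot>\<^sub>v v}"
  then show "a \<cdot>\<^sub>v u \<in> {v \<in> carrier_vec n. A *\<^sub>v v = \<mu> \<cdot>\<^sub>v v}"
    using A by (auto simp: mult_mat_vec smult_smult_assoc mult.commute)
qed (use A in auto)

lemma card_eigenspace_diag_fun_mat:
  "card (eigenspace n (diag_fun_mat n f) (\<mu> :: 'a::{field,finite}))
     = card (UNIV :: 'a set) ^ card {i. i < n \<and> f i = \<mu>}"
proof -
  have "diag_fun_mat n f *\<^sub>v v = \<mu> \<cdot>\<^sub>v v \<longleftrightarrow> (\<forall>i<n. f i * v $ i = \<mu> * v $ i)"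
    if "v \<in> carrier_vec n" for v
    using that by (auto simp: diag_fun_mat_mult_vec vec_eq_iff)
  moreover have "f i * x = \<mu> * x \<longleftrightarrow> x \<in> (if f i = \<mu> then UNIV else {0})" for i and x :: 'a
    by auto
  ultimately have "eigenspace n (diag_fun_mat n f) \<mu> = {v \<in> carrier_vec n. \<forall>i<n. v $ i \<in> (if f i = \<mu> then UNIV else {0})}"
    unfolding eigenspace_def by auto
  then have "card (eigenspace n (diag_fun_mat n f) \<mu>) = (\<Prod>i<n. card (if f i = \<mu> then UNIV else {0 :: 'a}))"
    by (simp only: card_vec_box)
  also have "\<dots> = (\<Prod>i<n. if f i = \<mu> then card (UNIV :: 'a set) else 1)"
    by (rule prod.cong) auto
  also have "\<dots> = (\<Prod>i\<in>{i \<in> {..<n}. f i = \<mu>}. card (UNIV :: 'a set))"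
    by (rule prod.inter_filter[symmetric]) simp
  also have "\<dots> = card (UNIV :: 'a set) ^ card {i. i < n \<and> f i = \<mu>}"
    by simp
  finally show ?thesis .
qed

lemma card_eigenspace_diag_xi:
  fixes xi :: "'a::{field,finite}"
  assumes "xi \<noteq> 1" "c \<le> n"
  shows "card (eigenspace n (diag_xi n c xi) xi) = card (UNIV :: 'a set) ^ c"
    and "card (eigenspace n (diag_xi n c xi) 1) = card (UNIV :: 'a set) ^ (n - c)"
proof -
  have "{i. i < n \<and> (if i < c then xi else 1) = xi} = {..<c}"
    "{i. i < n \<and> (if i < c then xi else 1) = 1} = {c..<n}"
    using assms by auto
  then show "card (eigenspace n (diag_xi n c xi) xi) = card (UNIV :: 'a set) ^ c"
    "card (eigenspace n (diag_xi n c xi) 1) = card (UNIV :: 'a set) ^ (n - c)"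
    unfolding diag_xi_eq_diag_fun_mat card_eigenspace_diag_fun_mat by simp_all
qed

section \<open>Conjugacy classes and centralizers\<close>

lemma card_eigenspace_similar:
  fixes A B :: "'a::{field,finite} mat"
  assumes "similar_mat A B" and A: "A \<in> carrier_mat n n"
  shows "card (eigenspace n A \<mu>) = card (eigenspace n B \<mu>)"
proof -
  obtain P Q where PQ: "B \<in> carrier_mat n n" "P \<in> carrier_mat n n" "Q \<in> carrier_mat n n"
    "P * Q = 1\<^sub>m n" "Q * P = 1\<^sub>m n" "A = P * B * Q"
    using similar_matD[OF assms(1)] A by (metis carrier_matD(1) insert_subset)
  note carriers = PQ(1-3)
  have AP: "A *\<^sub>v (P *\<^sub>v v) = P *\<^sub>v (B *\<^sub>v v)" if "v \<in> carrier_vec n" for v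
  proof -
    have "A *\<^sub>v (P *\<^sub>v v) = P *\<^sub>v (B *\<^sub>v ((Q * P) *\<^sub>v v))"
      using carriers that PQ(6) by (simp add: assoc_mult_mat[of _ n n _ n _ n] assoc_mult_mat_vec[of _ n n _ n])
    then show ?thesis
      using PQ(5) that by simp
  qed
  have QA: "Q *\<^sub>v (A *\<^sub>v w) = B *\<^sub>v (Q *\<^sub>v w)" if "w \<in> carrier_vec n" for w
  proof -
    have "Q *\<^sub>v (A *\<^sub>v w) = ((Q * P) * B) *\<^sub>v (Q *\<^sub>v w)"
      using carriers that PQ(6) by (simp add: assoc_mult_mat[of _ n n _ n _ n] assoc_mult_mat_vec[of _ n n _ n])
    then show ?thesis
      using PQ(5) carriers by simp
  qed
  have "bij_betw ((*\<^sub>v) P) (eigenspace n B \<mu>) (eigenspace n A \<mu>)"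
  proof (rule bij_betwI[where g = "(*\<^sub>v) Q"])
    show "(*\<^sub>v) P \<in> eigenspace n B \<mu> \<rightarrow> eigenspace n A \<mu>"
      using AP carriers by (auto simp: eigenspace_def mult_mat_vec)
    show "(*\<^sub>v) Q \<in> eigenspace n A \<mu> \<rightarrow> eigenspace n B \<mu>"
      using QA carriers by (auto simp: eigenspace_def mult_mat_vec simp flip: QA)
    show "Q *\<^sub>v (P *\<^sub>v v) = v" if "v \<in> eigenspace n B \<mu>" for v
      using that carriers PQ(5) by (auto simp: eigenspace_def simp flip: assoc_mult_mat_vec[of _ n n _ n])
    show "P *\<^sub>v (Q *\<^sub>v v) = v" if "v \<in> eigenspace n A \<mu>" for v
      using that carriers PQ(4) by (auto simp: eigenspace_def simp flip: assoc_mult_mat_vec[of _ n n _ n])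
  qed
  then show ?thesis
    by (simp add: bij_betw_same_card)
qed

lemma conj_class_carrier: "x \<in> conj_class n D \<Longrightarrow> x \<in> carrier_mat n n"
  unfolding conj_class_def by (auto intro: GL_carrier)

lemma finite_conj_class [simp]: "finite (conj_class n (D :: 'a::{field,finite} mat))"
  by (rule finite_subset[OF _ finite_GL[of n]]) (auto simp: conj_class_def)

lemma conj_classI:
  assumes "D \<in> GL n" "P \<in> carrier_mat n n" "Q \<in> carrier_mat n n" "P * Q = 1\<^sub>m n" "Q * P = 1\<^sub>m n"
  shows "P * D * Q \<in> conj_class n D"
proof -
  have "P * D * Q \<in> GL n"
    using assms GL_if_mult_eq_one[OF assms(2,3,4)] by (auto intro: GL_mult)
  moreover have "similar_mat (P * D * Q) D"
    using assms by (intro similar_matI[of _ _ P Q n]) (auto intro: GL_carrier)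
  ultimately show ?thesis
    unfolding conj_class_def by simp
qed

lemma conj_classE:
  assumes "x \<in> conj_class n D" "D \<in> carrier_mat n n"
  obtains P Q where "P \<in> carrier_mat n n" "Q \<in> carrier_mat n n" "P * Q = 1\<^sub>m n" "Q * P = 1\<^sub>m n"
    "x = P * D * Q"
proof -
  obtain n' P Q where wit: "{x, D, P, Q} \<subseteq> carrier_mat n' n'" "P * Q = 1\<^sub>m n'" "Q * P = 1\<^sub>m n'"
    "x = P * D * Q"
    using similar_matD assms(1) unfolding conj_class_def by blast
  moreover have "n' = n"
    using wit(1) assms(2) by auto
  ultimately show ?thesis
    using that by auto
qed

lemma card_eigenspace_conj_class:
  fixes D :: "'a::{field,finite} mat"
  assumes "x \<in> conj_class n D"
  shows "card (eigenspace n x \<mu>) = card (eigenspace n D \<mu>)"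
  using card_eigenspace_similar[of x D n \<mu>] assms conj_class_carrier[OF assms]
  unfolding conj_class_def by simp

lemma transpose_conj_class:
  assumes x: "x \<in> conj_class n D" and D: "D \<in> GL n"
  shows "transpose_mat x \<in> conj_class n (transpose_mat D)"
proof -
  have Dc: "D \<in> carrier_mat n n"
    using D by (rule GL_carrier)
  obtain P Q where PQ: "P \<in> carrier_mat n n" "Q \<in> carrier_mat n n" "P * Q = 1\<^sub>m n" "Q * P = 1\<^sub>m n"
    and xPQ: "x = P * D * Q"
    using conj_classE[OF x Dc] by blast
  have "transpose_mat x = transpose_mat Q * transpose_mat D * transpose_mat P"
    using PQ Dc xPQ by (simp add: transpose_mult[of _ n n _ n] assoc_mult_mat[of _ n n _ n _ n])
  moreover have "transpose_mat D \<in> GL n"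
    using D by (simp add: GL_iff_det det_transpose[OF Dc])
  moreover have "transpose_mat Q * transpose_mat P = 1\<^sub>m n" "transpose_mat P * transpose_mat Q = 1\<^sub>m n"
    using transpose_mult[OF PQ(1,2), symmetric] transpose_mult[OF PQ(2,1), symmetric] PQ(3,4) by simp_all
  ultimately show ?thesis
    using conj_classI[of "transpose_mat D" n "transpose_mat Q" "transpose_mat P"] PQ by simp
qed

definition centralizer :: "nat \<Rightarrow> 'a::field mat \<Rightarrow> 'a mat set" where
  "centralizer n D = {P \<in> GL n. D * P = P * D}"

definition transporter :: "nat \<Rightarrow> 'a::field mat \<Rightarrow> 'a mat \<Rightarrow> 'a mat set" where
  "transporter n D x = {P \<in> GL n. x * P = P * D}"

lemma card_transporter:
  fixes D :: "'a::{field,finite} mat"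
  assumes x: "x \<in> conj_class n D" and D: "D \<in> carrier_mat n n"
  shows "card (transporter n D x) = card (centralizer n D)"
proof -
  obtain P0 Q0 where PQ: "P0 \<in> carrier_mat n n" "Q0 \<in> carrier_mat n n" "P0 * Q0 = 1\<^sub>m n" "Q0 * P0 = 1\<^sub>m n"
    and xPQ: "x = P0 * D * Q0"
    using conj_classE[OF x D] by blast
  have G: "P0 \<in> GL n" "Q0 \<in> GL n"
    using GL_if_mult_eq_one[OF PQ(1-3)] by auto
  note [simp] = assoc_mult_mat[of _ n n _ n _ n]
  have "bij_betw ((*) P0) (centralizer n D) (transporter n D x)"
  proof (rule bij_betwI[where g = "(*) Q0"])
    show "(*) P0 \<in> centralizer n D \<rightarrow> transporter n D x"
    proof
      fix P assume "P \<in> centralizer n D"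
      then have P: "P \<in> GL n" "P \<in> carrier_mat n n" "D * P = P * D"
        unfolding centralizer_def by (auto intro: GL_carrier)
      have "x * (P0 * P) = P0 * (D * (Q0 * (P0 * P)))"
        using PQ P D xPQ by simp
      also have "\<dots> = P0 * P * D"
        using PQ P D by (simp add: mult_cancel_left_mat[OF PQ(2,1,4) P(2)])
      finally have "x * (P0 * P) = P0 * P * D" .
      then show "P0 * P \<in> transporter n D x"
        using GL_mult[OF G(1) P(1)] by (simp add: transporter_def)
    qed
    show "(*) Q0 \<in> transporter n D x \<rightarrow> centralizer n D"
    proof
      fix P assume "P \<in> transporter n D x"
      then have P: "P \<in> GL n" "P \<in> carrier_mat n n" "x * P = P * D"
        unfolding transporter_def by (auto intro: GL_carrier)
      have "Q0 * (x * P) = Q0 * (P0 * (D * (Q0 * P)))"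
        using PQ P D xPQ by simp
      also have "\<dots> = D * (Q0 * P)"
        using P D PQ by (auto intro!: mult_cancel_left_mat[OF PQ(2,1,4)] mult_carrier_mat)
      finally show "Q0 * P \<in> centralizer n D"
        using GL_mult[OF G(2) P(1)] P PQ D unfolding centralizer_def by simp
    qed
    show "Q0 * (P0 * P) = P" if "P \<in> centralizer n D" for P
      using that unfolding centralizer_def by (auto intro!: mult_cancel_left_mat[OF PQ(2,1,4)] GL_carrier)
    show "P0 * (Q0 * P) = P" if "P \<in> transporter n D x" for P
      using that unfolding transporter_def by (auto intro!: mult_cancel_left_mat[OF PQ(1,2,3)] GL_carrier)
  qed
  then show ?thesis
    by (simp add: bij_betw_same_card)
qed

lemma GL_eq_UN_transporter:
  fixes D :: "'a::field mat"
  assumes D: "D \<in> GL n"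
  shows "GL n = (\<Union>x\<in>conj_class n D. transporter n D x)"
proof (intro equalityI subsetI)
  fix P :: "'a mat" assume P: "P \<in> GL n"
  then obtain Q where Q: "Q \<in> carrier_mat n n" "P * Q = 1\<^sub>m n" "Q * P = 1\<^sub>m n"
    by (rule GL_inverseE)
  have "P * D * Q \<in> conj_class n D"
    using conj_classI[OF D GL_carrier[OF P] Q] .
  moreover have "P * D * Q * P = P * D"
    using P Q GL_carrier[OF D] by (simp add: GL_carrier assoc_mult_mat[of _ n n _ n _ n])
  ultimately show "P \<in> (\<Union>x\<in>conj_class n D. transporter n D x)"
    using P unfolding transporter_def by blast
qed (auto simp: transporter_def)

lemma transporter_disjoint:
  assumes "x \<in> conj_class n D" "y \<in> conj_class n D" "x \<noteq> y"
  shows "transporter n D x \<inter> transporter n D y = {}"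
proof (rule ccontr)
  assume "transporter n D x \<inter> transporter n D y \<noteq> {}"
  then obtain P where P: "P \<in> GL n" "x * P = P * D" "y * P = P * D"
    unfolding transporter_def by blast
  obtain Q where Q: "Q \<in> carrier_mat n n" "P * Q = 1\<^sub>m n"
    using GL_inverseE[OF P(1)] by blast
  have "x = x * P * Q" "y = y * P * Q"
    using conj_class_carrier[OF assms(1)] conj_class_carrier[OF assms(2)] Q GL_carrier[OF P(1)]
    by (simp_all add: assoc_mult_mat[of _ n n _ n _ n])
  then show False
    using P(2,3) assms(3) by simp
qed

lemma card_GL_eq_conj_class_centralizer:
  fixes D :: "'a::{field,finite} mat"
  assumes D: "D \<in> GL n"
  shows "card (GL n :: 'a mat set) = card (conj_class n D) * card (centralizer n D)"
proof -
  have "card (GL n :: 'a mat set) = (\<Sum>x\<in>conj_class n D. card (transporter n D x))"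
    unfolding GL_eq_UN_transporter[OF D]
  proof (rule card_UN_disjoint)
    show "\<forall>x\<in>conj_class n D. finite (transporter n D x)"
      by (simp add: transporter_def)
    show "\<forall>x\<in>conj_class n D. \<forall>y\<in>conj_class n D. x \<noteq> y \<longrightarrow> transporter n D x \<inter> transporter n D y = {}"
      using transporter_disjoint by blast
  qed simp
  also have "\<dots> = (\<Sum>x\<in>conj_class n D. card (centralizer n D))"
    using card_transporter[OF _ GL_carrier[OF D]] by simp
  finally show ?thesis
    by simp
qed

section \<open>Block diagonal matrices\<close>

definition block_diag_mat :: "'a::zero mat \<Rightarrow> 'a mat \<Rightarrow> 'a mat" where
  "block_diag_mat A B = four_block_mat A (0\<^sub>m (dim_row A) (dim_col B)) (0\<^sub>m (dim_row B) (dim_col A)) B"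

lemma dim_block_diag_mat [simp]:
  "dim_row (block_diag_mat A B) = dim_row A + dim_row B" "dim_col (block_diag_mat A B) = dim_col A + dim_col B"
  unfolding block_diag_mat_def by simp_all

lemma block_diag_mat_carrier [simp]:
  "A \<in> carrier_mat c c \<Longrightarrow> B \<in> carrier_mat d d \<Longrightarrow> block_diag_mat A B \<in> carrier_mat (c + d) (c + d)"
  unfolding block_diag_mat_def by simp

lemma index_block_diag_mat:
  assumes "A \<in> carrier_mat c c" "B \<in> carrier_mat d d" "i < c + d" "j < c + d"
  shows "block_diag_mat A B $$ (i, j) =
    (if i < c \<and> j < c then A $$ (i, j) else if c \<le> i \<and> c \<le> j then B $$ (i - c, j - c) else 0)"
  using assms unfolding block_diag_mat_def by auto

lemma det_block_diag_mat:
  fixes A :: "'a::idom mat"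
  assumes "A \<in> carrier_mat c c" "B \<in> carrier_mat d d"
  shows "det (block_diag_mat A B) = det A * det B"
  using assms unfolding block_diag_mat_def
  by (intro det_four_block_mat_lower_left_zero) auto

lemma block_diag_mat_mult:
  fixes A :: "'a::semiring_0 mat"
  assumes "A \<in> carrier_mat c c" "B \<in> carrier_mat d d" "A' \<in> carrier_mat c c" "B' \<in> carrier_mat d d"
  shows "block_diag_mat A B * block_diag_mat A' B' = block_diag_mat (A * A') (B * B')"
  using assms unfolding block_diag_mat_def
  by (simp add: mult_four_block_mat[OF assms(1) zero_carrier_mat zero_carrier_mat assms(2)
        assms(3) zero_carrier_mat zero_carrier_mat assms(4)])

lemma block_diag_mat_mult_vec:
  fixes A :: "'a::semiring_0 mat"
  assumes "A \<in> carrier_mat c c" "B \<in> carrier_mat d d" "a \<in> carrier_vec c" "b \<in> carrier_vec d"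
  shows "block_diag_mat A B *\<^sub>v (a @\<^sub>v b) = (A *\<^sub>v a) @\<^sub>v (B *\<^sub>v b)"
proof -
  have "0\<^sub>m m k *\<^sub>v v = 0\<^sub>v m" if "v \<in> carrier_vec k" for m k and v :: "'a vec"
    using that by (intro eq_vecI) (auto simp: scalar_prod_def)
  then show ?thesis
    using assms unfolding block_diag_mat_def
    by (simp add: four_block_mat_mult_vec[OF assms(1) zero_carrier_mat zero_carrier_mat assms(2,3,4)])
qed

lemma block_diag_mat_inject:
  assumes "A \<in> carrier_mat c c" "B \<in> carrier_mat d d" "A' \<in> carrier_mat c c" "B' \<in> carrier_mat d d"
    and "block_diag_mat A B = block_diag_mat A' B'"
  shows "A = A'" "B = B'"
proof -
  have "A $$ (i, j) = A' $$ (i, j)" if "i < c" "j < c" for i j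
    using arg_cong[OF assms(5), of "\<lambda>M. M $$ (i, j)"] assms(1-4) that by (simp add: index_block_diag_mat)
  then show "A = A'"
    using assms(1,3) by (intro eq_matI) auto
  have "B $$ (i, j) = B' $$ (i, j)" if "i < d" "j < d" for i j
    using arg_cong[OF assms(5), of "\<lambda>M. M $$ (c + i, c + j)"] assms(1-4) that by (simp add: index_block_diag_mat)
  then show "B = B'"
    using assms(2,4) by (intro eq_matI) auto
qed

lemma card_eigenspace_block_diag_mat:
  fixes A :: "'a::{field,finite} mat"
  assumes A: "A \<in> carrier_mat c c" and B: "B \<in> carrier_mat d d"
  shows "card (eigenspace (c + d) (block_diag_mat A B) \<mu>) = card (eigenspace c A \<mu>) * card (eigenspace d B \<mu>)"
proof -
  have smult: "\<mu> \<cdot>\<^sub>v (a @\<^sub>v b) = (\<mu> \<cdot>\<^sub>v a) @\<^sub>v (\<mu> \<cdot>\<^sub>v b)" for a b :: "'a vec"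
    by (intro eq_vecI) auto
  have eigen_append: "a @\<^sub>v b \<in> eigenspace (c + d) (block_diag_mat A B) \<mu> \<longleftrightarrow>
      a \<in> eigenspace c A \<mu> \<and> b \<in> eigenspace d B \<mu>"
    if "a \<in> carrier_vec c" "b \<in> carrier_vec d" for a b
    using that A B by (auto simp: eigenspace_def block_diag_mat_mult_vec smult append_vec_eq[of _ c])
  have "eigenspace (c + d) (block_diag_mat A B) \<mu> = (\<lambda>(a, b). a @\<^sub>v b) ` (eigenspace c A \<mu> \<times> eigenspace d B \<mu>)"
  proof (intro equalityI subsetI)
    fix v assume v: "v \<in> eigenspace (c + d) (block_diag_mat A B) \<mu>"
    then have "v = vec_first v c @\<^sub>v vec_last v d"
      by (simp add: eigenspace_def)
    then show "v \<in> (\<lambda>(a, b). a @\<^sub>v b) ` (eigenspace c A \<mu> \<times> eigenspace d B \<mu>)"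
      using v eigen_append[OF vec_first_carrier vec_last_carrier] by (metis (no_types, lifting) SigmaI case_prod_conv image_eqI)
  qed (use eigen_append eigenspace_carrier in fastforce)
  moreover have "inj_on (\<lambda>(a, b). a @\<^sub>v b) (eigenspace c A \<mu> \<times> eigenspace d B \<mu>)"
  proof (rule inj_onI, clarify)
    fix a b a' b' assume "a \<in> eigenspace c A \<mu>" "a' \<in> eigenspace c A \<mu>" "a @\<^sub>v b = a' @\<^sub>v b'"
    then show "a = a' \<and> b = b'"
      using append_vec_eq[of a c a'] eigenspace_carrier by blast
  qed
  ultimately show ?thesis
    by (simp add: card_image card_cartesian_product)
qed

lemma diag_xi_commute_iff:
  fixes xi :: "'a::field"
  assumes xi: "xi \<noteq> 1" and P: "P \<in> carrier_mat n n"
  shows "diag_xi n c xi * P = P * diag_xi n c xi \<longleftrightarrow> (\<forall>i<n. \<forall>j<n. (i < c) \<noteq> (j < c) \<longrightarrow> P $$ (i, j) = 0)"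
proof -
  have "(if i < c then xi else 1) \<noteq> (if j < c then xi else 1) \<longleftrightarrow> (i < c) \<noteq> (j < c)" for i j
    using xi by auto
  then show ?thesis
    unfolding diag_xi_eq_diag_fun_mat diag_fun_mat_commute_iff[OF P] by presburger
qed

lemma centralizer_diag_xi:
  fixes xi :: "'a::field"
  assumes xi: "xi \<noteq> 1"
  shows "centralizer (c + d) (diag_xi (c + d) c xi) = (\<lambda>(A, B). block_diag_mat A B) ` (GL c \<times> GL d)"
proof (intro equalityI subsetI)
  fix P :: "'a mat" assume "P \<in> centralizer (c + d) (diag_xi (c + d) c xi)"
  then have P: "P \<in> GL (c + d)" "P \<in> carrier_mat (c + d) (c + d)"
    and comm: "diag_xi (c + d) c xi * P = P * diag_xi (c + d) c xi"
    unfolding centralizer_def by (auto intro: GL_carrier)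
  then have zero: "\<forall>i<c + d. \<forall>j<c + d. (i < c) \<noteq> (j < c) \<longrightarrow> P $$ (i, j) = 0"
    using diag_xi_commute_iff[OF xi P(2)] by simp
  define A where "A = mat c c (\<lambda>(i, j). P $$ (i, j))"
  define B where "B = mat d d (\<lambda>(i, j). P $$ (c + i, c + j))"
  have AB: "A \<in> carrier_mat c c" "B \<in> carrier_mat d d"
    unfolding A_def B_def by auto
  have "P $$ (i, j) = block_diag_mat A B $$ (i, j)" if "i < c + d" "j < c + d" for i j
    using zero that unfolding index_block_diag_mat[OF AB that] by (auto simp: A_def B_def)
  then have "P = block_diag_mat A B"
    using P(2) AB by (intro eq_matI) auto
  moreover from this have "A \<in> GL c" "B \<in> GL d"
    using P(1) AB by (auto simp: GL_iff_det det_block_diag_mat)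
  ultimately show "P \<in> (\<lambda>(A, B). block_diag_mat A B) ` (GL c \<times> GL d)"
    by blast
next
  fix P :: "'a mat" assume "P \<in> (\<lambda>(A, B). block_diag_mat A B) ` (GL c \<times> GL d)"
  then obtain A B :: "'a mat" where AB: "A \<in> GL c" "B \<in> GL d" and P: "P = block_diag_mat A B"
    by auto
  have A: "A \<in> carrier_mat c c" and B: "B \<in> carrier_mat d d"
    using AB by (auto intro: GL_carrier)
  have Pc: "P \<in> carrier_mat (c + d) (c + d)"
    using A B P by simp
  moreover have "P \<in> GL (c + d)"
    using AB A B P by (simp add: GL_iff_det det_block_diag_mat)
  moreover have "\<forall>i<c + d. \<forall>j<c + d. (i < c) \<noteq> (j < c) \<longrightarrow> P $$ (i, j) = 0"
    using A B P by (auto simp: index_block_diag_mat)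
  ultimately show "P \<in> centralizer (c + d) (diag_xi (c + d) c xi)"
    unfolding centralizer_def using diag_xi_commute_iff[OF xi Pc] by simp
qed

lemma card_centralizer_diag_xi:
  fixes xi :: "'a::{field,finite}"
  assumes "xi \<noteq> 1"
  shows "card (centralizer (c + d) (diag_xi (c + d) c xi)) = card (GL c :: 'a mat set) * card (GL d :: 'a mat set)"
proof -
  have "inj_on (\<lambda>(A, B). block_diag_mat A B) (GL c \<times> GL d :: ('a mat \<times> 'a mat) set)"
  proof (rule inj_onI, clarify)
    fix A B A' B' :: "'a mat"
    assume "A \<in> GL c" "B \<in> GL d" "A' \<in> GL c" "B' \<in> GL d" "block_diag_mat A B = block_diag_mat A' B'"
    then show "A = A' \<and> B = B'"
      using block_diag_mat_inject[of A c B d A' B'] by (simp add: GL_carrier)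
  qed
  then show ?thesis
    by (simp add: centralizer_diag_xi[OF assms] card_image card_cartesian_product)
qed

section \<open>Counting characterization of the class of diag_xi\<close>

lemma mat_eqI_mult_vec:
  fixes A B :: "'a::semiring_1 mat"
  assumes "A \<in> carrier_mat n m" "B \<in> carrier_mat n m" "\<And>x. x \<in> carrier_vec m \<Longrightarrow> A *\<^sub>v x = B *\<^sub>v x"
  shows "A = B"
proof (rule eq_matI)
  fix i j assume "i < dim_row B" "j < dim_col B"
  then show "A $$ (i, j) = B $$ (i, j)"
    using assms(1,2) arg_cong[OF assms(3)[OF unit_vec_carrier[of m j]], of "\<lambda>v. v $ i"] by simp
qed (use assms in auto)

lemma diag_xi_mult_append_vec:
  assumes "k \<le> m" "a \<in> carrier_vec k" "b \<in> carrier_vec (m - k)"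
  shows "diag_xi m k xi *\<^sub>v (a @\<^sub>v b) = (xi \<cdot>\<^sub>v a) @\<^sub>v b"
proof -
  have "a @\<^sub>v b \<in> carrier_vec m"
    using assms append_carrier_vec[OF assms(2,3)] by simp
  then show ?thesis
    using assms by (intro eq_vecI) (auto simp: diag_xi_eq_diag_fun_mat diag_fun_mat_mult_vec)
qed

lemma eigenspace_inter_eigenspace:
  fixes \<alpha> \<beta> :: "'a::field"
  assumes "\<alpha> \<noteq> \<beta>"
  shows "eigenspace n A \<alpha> \<inter> eigenspace n A \<beta> \<subseteq> {0\<^sub>v n}"
proof
  fix v assume "v \<in> eigenspace n A \<alpha> \<inter> eigenspace n A \<beta>"
  then have v: "v \<in> carrier_vec n" "\<alpha> \<cdot>\<^sub>v v = \<beta> \<cdot>\<^sub>v v"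
    unfolding eigenspace_def by auto
  have "v $ i = 0" if "i < n" for i
    using arg_cong[OF v(2), of "\<lambda>v. v $ i"] v(1) that assms by auto
  then show "v \<in> {0\<^sub>v n}"
    using v(1) by (auto intro!: eq_vecI)
qed

lemma mult_append_cols_eigenbases:
  fixes A :: "'a::field mat"
  assumes A: "A \<in> carrier_mat m m" and k: "k \<le> m"
    and M1: "M1 \<in> carrier_mat m k" and M2: "M2 \<in> carrier_mat m (m - k)"
    and im1: "(*\<^sub>v) M1 ` carrier_vec k \<subseteq> eigenspace m A xi"
    and im2: "(*\<^sub>v) M2 ` carrier_vec (m - k) \<subseteq> eigenspace m A 1"
  shows "A * append_cols M1 M2 = append_cols M1 M2 * diag_xi m k xi"
proof (rule mat_eqI_mult_vec)
  have P: "append_cols M1 M2 \<in> carrier_mat m m"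
    using append_cols_carrier[OF M1 M2] k by simp
  then show "A * append_cols M1 M2 \<in> carrier_mat m m" "append_cols M1 M2 * diag_xi m k xi \<in> carrier_mat m m"
    using A by auto
  fix x :: "'a vec" assume xc: "x \<in> carrier_vec m"
  then obtain a b where x: "x = a @\<^sub>v b" and a: "a \<in> carrier_vec k" and b: "b \<in> carrier_vec (m - k)"
    using k by (metis le_add_diff_inverse vec_first_carrier vec_first_last_append vec_last_carrier)
  have "M1 *\<^sub>v a \<in> eigenspace m A xi" "M2 *\<^sub>v b \<in> eigenspace m A 1"
    using im1 im2 a b by auto
  then have eigen: "A *\<^sub>v (M1 *\<^sub>v a) = M1 *\<^sub>v (xi \<cdot>\<^sub>v a)" "A *\<^sub>v (M2 *\<^sub>v b) = M2 *\<^sub>v b"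
    using M1 a by (simp_all add: eigenspace_def mult_mat_vec)
  have "(A * append_cols M1 M2) *\<^sub>v x = A *\<^sub>v (M1 *\<^sub>v a + M2 *\<^sub>v b)"
    using A P xc M1 M2 a b by (simp add: x append_cols_mult_vec)
  also have "\<dots> = M1 *\<^sub>v (xi \<cdot>\<^sub>v a) + M2 *\<^sub>v b"
    using A M1 M2 a b eigen by (simp add: mult_add_distrib_mat_vec)
  also have "\<dots> = append_cols M1 M2 *\<^sub>v (diag_xi m k xi *\<^sub>v x)"
    using M1 M2 a b k by (simp add: x append_cols_mult_vec diag_xi_mult_append_vec)
  also have "\<dots> = (append_cols M1 M2 * diag_xi m k xi) *\<^sub>v x"
    using P xc by (simp add: assoc_mult_mat_vec[of _ m m _ m])
  finally show "(A * append_cols M1 M2) *\<^sub>v x = (append_cols M1 M2 * diag_xi m k xi) *\<^sub>v x" .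
qed

lemma conj_class_diag_xiI:
  fixes A :: "'a::{field,finite} mat"
  assumes A: "A \<in> carrier_mat m m" and k: "k \<le> m" and xi: "xi \<noteq> 0" "xi \<noteq> 1"
    and card_xi: "card (UNIV :: 'a set) ^ k \<le> card (eigenspace m A xi)"
    and card_1: "card (UNIV :: 'a set) ^ (m - k) \<le> card (eigenspace m A 1)"
  shows "A \<in> conj_class m (diag_xi m k xi)"
proof -
  have q: "2 \<le> card (UNIV :: 'a set)"
    by (rule card_UNIV_field_ge_2)
  obtain k1 M1 where M1: "M1 \<in> injective_mats m k1" and im1: "(*\<^sub>v) M1 ` carrier_vec k1 = eigenspace m A xi"
    using vec_subspace_eq_image[OF vec_subspace_eigenspace[OF A]] .
  obtain k2 M2 where M2: "M2 \<in> injective_mats m k2" and im2: "(*\<^sub>v) M2 ` carrier_vec k2 = eigenspace m A 1"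
    using vec_subspace_eq_image[OF vec_subspace_eigenspace[OF A]] .
  have "k \<le> k1" "m - k \<le> k2"
    using card_xi card_1 card_image_injective_mat[OF M1] card_image_injective_mat[OF M2] im1 im2 q
    by (simp_all add: power_le_imp_le_exp)
  define P where "P = append_cols M1 M2"
  have "P \<in> injective_mats m (k1 + k2)"
    unfolding P_def using append_cols_injective[OF M1 M2] eigenspace_inter_eigenspace[OF xi(2)] im1 im2 by simp
  then have "k1 + k2 \<le> m"
    by (rule injective_mats_le)
  then have k12: "k1 = k" "k2 = m - k"
    using \<open>k \<le> k1\<close> \<open>m - k \<le> k2\<close> k by linarith+
  then have PG: "P \<in> GL m"
    using \<open>P \<in> injective_mats m (k1 + k2)\<close> k by (simp add: GL_eq_injective_mats)
  have AP: "A * P = P * diag_xi m k xi"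
    unfolding P_def using M1 M2 im1 im2 k12
    by (intro mult_append_cols_eigenbases[OF A k]) (auto dest: injective_mats_carrier)
  obtain Q where Q: "Q \<in> carrier_mat m m" "P * Q = 1\<^sub>m m" "Q * P = 1\<^sub>m m"
    using GL_inverseE[OF PG] by blast
  then have "A = P * diag_xi m k xi * Q"
    using AP A GL_carrier[OF PG] by (metis assoc_mult_mat right_mult_one_mat)
  then show ?thesis
    using conj_classI[OF diag_xi_GL[OF xi(1)] GL_carrier[OF PG] Q] by simp
qed

lemma conj_class_diag_xi_iff:
  fixes A :: "'a::{field,finite} mat"
  assumes k: "k \<le> m" and xi: "xi \<noteq> 0" "xi \<noteq> 1"
  shows "A \<in> conj_class m (diag_xi m k xi) \<longleftrightarrow> A \<in> carrier_mat m m
    \<and> card (eigenspace m A xi) = card (UNIV :: 'a set) ^ k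
    \<and> card (eigenspace m A 1) = card (UNIV :: 'a set) ^ (m - k)"
proof
  assume "A \<in> conj_class m (diag_xi m k xi)"
  then show "A \<in> carrier_mat m m \<and> card (eigenspace m A xi) = card (UNIV :: 'a set) ^ k
      \<and> card (eigenspace m A 1) = card (UNIV :: 'a set) ^ (m - k)"
    using conj_class_carrier card_eigenspace_conj_class card_eigenspace_diag_xi[OF xi(2) k] by metis
qed (use conj_class_diag_xiI[OF _ k xi] in simp)

section \<open>The embedding of GL(N) into GL(n)\<close>

definition embed_mat :: "nat \<Rightarrow> 'a::{zero,one} mat \<Rightarrow> 'a mat" where
  "embed_mat n A = block_diag_mat A (1\<^sub>m (n - dim_row A))"

lemma embed_mat_carrier [simp]:
  "A \<in> carrier_mat N N \<Longrightarrow> N \<le> n \<Longrightarrow> embed_mat n A \<in> carrier_mat n n"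
  unfolding embed_mat_def using block_diag_mat_carrier[of A N "1\<^sub>m (n - N)" "n - N"] by simp

lemma embed_mat_mult:
  fixes A B :: "'a::semiring_1 mat"
  assumes "A \<in> carrier_mat N N" "B \<in> carrier_mat N N"
  shows "embed_mat n (A * B) = embed_mat n A * embed_mat n B"
  using assms by (simp add: embed_mat_def block_diag_mat_mult[of A N "1\<^sub>m (n - N)" "n - N"])

lemma inj_on_embed_mat: "inj_on (embed_mat n) (carrier_mat N N)"
proof (rule inj_onI)
  fix A B :: "'a mat" assume "A \<in> carrier_mat N N" "B \<in> carrier_mat N N" "embed_mat n A = embed_mat n B"
  then show "A = B"
    using block_diag_mat_inject(1)[of A N "1\<^sub>m (n - N)" "n - N" B "1\<^sub>m (n - N)"] by (simp add: embed_mat_def)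
qed

lemma card_eigenspace_one_mat:
  "card (eigenspace n (1\<^sub>m n) (\<mu> :: 'a::{field,finite})) = (if \<mu> = 1 then card (UNIV :: 'a set) ^ n else 1)"
proof -
  have "1\<^sub>m n = diag_fun_mat n (\<lambda>_. 1 :: 'a)"
    by (auto simp: diag_fun_mat_def intro!: eq_matI)
  then show ?thesis
    by (simp add: card_eigenspace_diag_fun_mat)
qed

lemma card_eigenspace_embed_mat:
  fixes A :: "'a::{field,finite} mat"
  assumes "A \<in> carrier_mat N N" "N \<le> n"
  shows "card (eigenspace n (embed_mat n A) \<mu>) =
    card (eigenspace N A \<mu>) * (if \<mu> = 1 then card (UNIV :: 'a set) ^ (n - N) else 1)"
  using assms card_eigenspace_block_diag_mat[OF assms(1) one_carrier_mat[of "n - N"], of \<mu>]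
  by (simp add: embed_mat_def card_eigenspace_one_mat)

lemma embed_mat_smult_one: "N \<le> n \<Longrightarrow> embed_mat n (xi \<cdot>\<^sub>m 1\<^sub>m N) = diag_xi n N xi"
  by (auto simp: embed_mat_def diag_xi_def index_block_diag_mat[of _ N _ "n - N"] intro!: eq_matI)

lemma embed_mat_top_block:
  assumes x: "x \<in> carrier_mat n n" and "N \<le> n"
    and unit: "\<And>i j. i < n \<Longrightarrow> j < n \<Longrightarrow> N \<le> i \<or> N \<le> j \<Longrightarrow> x $$ (i, j) = (if i = j then 1 else 0)"
  shows "x = embed_mat n (mat N N (\<lambda>(i, j). x $$ (i, j)))"
  using assms
  by (intro eq_matI) (auto simp: embed_mat_def index_block_diag_mat[of _ N _ "n - N"])

section \<open>Factorizations of diag_xi\<close>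

lemma eigenspace_one_mult_subset:
  fixes a b :: "'a::{field,finite} mat"
  assumes a: "a \<in> carrier_mat n n" and b: "b \<in> carrier_mat n n"
    and card: "card (UNIV :: 'a set) ^ n * card (eigenspace n (a * b) 1) \<le> card (eigenspace n a 1) * card (eigenspace n b 1)"
  shows "eigenspace n (a * b) 1 \<subseteq> eigenspace n a 1 \<inter> eigenspace n b 1"
proof -
  have sub: "eigenspace n a 1 \<inter> eigenspace n b 1 \<subseteq> eigenspace n (a * b) 1"
    using a b by (auto simp: eigenspace_def)
  have "card (eigenspace n a 1) * card (eigenspace n b 1) \<le> card (UNIV :: 'a set) ^ n * card (eigenspace n a 1 \<inter> eigenspace n b 1)"
    using card_vec_subspace_inter[OF vec_subspace_eigenspace[OF a] vec_subspace_eigenspace[OF b]] .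
  with card have "card (UNIV :: 'a set) ^ n * card (eigenspace n (a * b) 1)
      \<le> card (UNIV :: 'a set) ^ n * card (eigenspace n a 1 \<inter> eigenspace n b 1)"
    by (rule le_trans)
  then have "card (eigenspace n (a * b) 1) \<le> card (eigenspace n a 1 \<inter> eigenspace n b 1)"
    by (simp add: finite_UNIV_card_ge_0)
  then show ?thesis
    using card_seteq[OF finite_eigenspace sub] by blast
qed

lemma unit_vec_eigenspace_diag_xi: "c \<le> j \<Longrightarrow> j < n \<Longrightarrow> unit_vec n j \<in> eigenspace n (diag_xi n c xi) 1"
  by (auto simp: eigenspace_def diag_xi_eq_diag_fun_mat diag_fun_mat_mult_vec intro!: eq_vecI)

lemma transpose_diag_xi [simp]: "transpose_mat (diag_xi n c xi) = diag_xi n c xi"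
  unfolding diag_xi_def by (intro eq_matI) auto

lemma fixed_space_diag_xi_subset_factors:
  fixes xi :: "'a::{field,finite}"
  assumes x: "x \<in> conj_class n (diag_xi n c xi)" and y: "y \<in> conj_class n (diag_xi n d xi)"
    and xy: "x * y = diag_xi n (c + d) xi" and xi: "xi \<noteq> 1" and N: "c + d \<le> n"
  shows "eigenspace n (diag_xi n (c + d) xi) 1 \<subseteq> eigenspace n x 1 \<inter> eigenspace n y 1"
proof -
  let ?q = "card (UNIV :: 'a set)"
  have card_fix: "card (eigenspace n u 1) = ?q ^ (n - k)"
    if "u \<in> conj_class n (diag_xi n k xi)" "k \<le> n" for u k
    using that card_eigenspace_conj_class card_eigenspace_diag_xi(2)[OF xi] by metis
  have "?q ^ n * ?q ^ (n - (c + d)) = ?q ^ (n - c) * ?q ^ (n - d)"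
    using N by (simp flip: power_add)
  then have "?q ^ n * card (eigenspace n (x * y) 1) \<le> card (eigenspace n x 1) * card (eigenspace n y 1)"
    using card_fix[OF x] card_fix[OF y] N card_eigenspace_diag_xi(2)[OF xi N] unfolding xy by simp
  from eigenspace_one_mult_subset[OF conj_class_carrier[OF x] conj_class_carrier[OF y] this]
  show ?thesis
    unfolding xy .
qed

lemma factor_eq_embed_mat:
  fixes xi :: "'a::{field,finite}"
  assumes x: "x \<in> conj_class n (diag_xi n c xi)" and y: "y \<in> conj_class n (diag_xi n d xi)"
    and xy: "x * y = diag_xi n (c + d) xi" and xi: "xi \<noteq> 0" "xi \<noteq> 1" and N: "c + d \<le> n"
  shows "x = embed_mat n (mat (c + d) (c + d) (\<lambda>(i, j). x $$ (i, j)))"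
proof -
  have xc: "x \<in> carrier_mat n n" and yc: "y \<in> carrier_mat n n"
    using x y by (auto intro: conj_class_carrier)
  have yT: "transpose_mat y \<in> conj_class n (diag_xi n d xi)" and xT: "transpose_mat x \<in> conj_class n (diag_xi n c xi)"
    using transpose_conj_class[OF x diag_xi_GL[OF xi(1)]] transpose_conj_class[OF y diag_xi_GL[OF xi(1)]] by simp_all
  have "transpose_mat y * transpose_mat x = diag_xi n (d + c) xi"
    using xy transpose_mult[OF xc yc] by (simp add: add.commute)
  from fixed_space_diag_xi_subset_factors[OF yT xT this xi(2)] N
  have "eigenspace n (diag_xi n (c + d) xi) 1 \<subseteq> eigenspace n (transpose_mat x) 1"
    unfolding add.commute[of d c] by blast
  then have "eigenspace n (diag_xi n (c + d) xi) 1 \<subseteq> eigenspace n x 1 \<inter> eigenspace n (transpose_mat x) 1"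
    using fixed_space_diag_xi_subset_factors[OF x y xy xi(2) N] by blast
  then have fix_x: "unit_vec n j \<in> eigenspace n x 1" and fix_xT: "unit_vec n j \<in> eigenspace n (transpose_mat x) 1"
    if "c + d \<le> j" "j < n" for j
    using unit_vec_eigenspace_diag_xi[OF that] by blast+
  show ?thesis
  proof (rule embed_mat_top_block[OF xc N])
    fix i j assume ij: "i < n" "j < n" "c + d \<le> i \<or> c + d \<le> j"
    show "x $$ (i, j) = (if i = j then 1 else 0)"
    proof (cases "c + d \<le> j")
      case True
      then have "(x *\<^sub>v unit_vec n j) $ i = unit_vec n j $ i"
        using fix_x[OF True ij(2)] by (simp add: eigenspace_def)
      then show ?thesis
        using xc ij by simp
    next
      case False
      then have "(transpose_mat x *\<^sub>v unit_vec n i) $ j = unit_vec n i $ j"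
        using fix_xT[of i] ij by (simp add: eigenspace_def)
      then show ?thesis
        using xc ij by auto
    qed
  qed
qed

lemma smult_mat_mult_vec:
  fixes A :: "'a::comm_semiring_0 mat"
  assumes "A \<in> carrier_mat n m" "v \<in> carrier_vec m"
  shows "(a \<cdot>\<^sub>m A) *\<^sub>v v = a \<cdot>\<^sub>v (A *\<^sub>v v)"
  using assms by (intro eq_vecI) (auto simp: scalar_prod_def sum_distrib_left mult.assoc)

lemma eigenspace_smult_inverse:
  fixes A B :: "'a::field mat"
  assumes A: "A \<in> carrier_mat n n" and B: "B \<in> carrier_mat n n" and AB: "A * B = 1\<^sub>m n" and BA: "B * A = 1\<^sub>m n"
    and a: "a \<noteq> 0" and \<mu>: "\<mu> \<noteq> 0"
  shows "eigenspace n (a \<cdot>\<^sub>m B) (a / \<mu>) = eigenspace n A \<mu>"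
proof -
  have "(a \<cdot>\<^sub>m B) *\<^sub>v v = (a / \<mu>) \<cdot>\<^sub>v v \<longleftrightarrow> A *\<^sub>v v = \<mu> \<cdot>\<^sub>v v" if v: "v \<in> carrier_vec n" for v
  proof -
    have "(a \<cdot>\<^sub>m B) *\<^sub>v v = (a / \<mu>) \<cdot>\<^sub>v v \<longleftrightarrow> B *\<^sub>v v = inverse \<mu> \<cdot>\<^sub>v v"
    proof
      assume "(a \<cdot>\<^sub>m B) *\<^sub>v v = (a / \<mu>) \<cdot>\<^sub>v v"
      then have "inverse a \<cdot>\<^sub>v (a \<cdot>\<^sub>v (B *\<^sub>v v)) = inverse a \<cdot>\<^sub>v ((a / \<mu>) \<cdot>\<^sub>v v)"
        using B v by (simp add: smult_mat_mult_vec)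
      then show "B *\<^sub>v v = inverse \<mu> \<cdot>\<^sub>v v"
        using a by (simp add: smult_smult_assoc field_simps)
    qed (use B v in \<open>simp add: smult_mat_mult_vec smult_smult_assoc field_simps\<close>)
    also have "\<dots> \<longleftrightarrow> A *\<^sub>v v = \<mu> \<cdot>\<^sub>v v"
    proof
      assume "B *\<^sub>v v = inverse \<mu> \<cdot>\<^sub>v v"
      then have "A *\<^sub>v (B *\<^sub>v v) = inverse \<mu> \<cdot>\<^sub>v (A *\<^sub>v v)"
        using A v by (simp add: mult_mat_vec)
      then have "\<mu> \<cdot>\<^sub>v v = \<mu> \<cdot>\<^sub>v (inverse \<mu> \<cdot>\<^sub>v (A *\<^sub>v v))"
        using A B AB v by (simp flip: assoc_mult_mat_vec[of _ n n _ n])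
      then show "A *\<^sub>v v = \<mu> \<cdot>\<^sub>v v"
        using \<mu> by (simp add: smult_smult_assoc)
    next
      assume "A *\<^sub>v v = \<mu> \<cdot>\<^sub>v v"
      then have "B *\<^sub>v (A *\<^sub>v v) = \<mu> \<cdot>\<^sub>v (B *\<^sub>v v)"
        using B v by (simp add: mult_mat_vec)
      then have "inverse \<mu> \<cdot>\<^sub>v v = inverse \<mu> \<cdot>\<^sub>v (\<mu> \<cdot>\<^sub>v (B *\<^sub>v v))"
        using A B BA v by (simp flip: assoc_mult_mat_vec[of _ n n _ n])
      then show "B *\<^sub>v v = inverse \<mu> \<cdot>\<^sub>v v"
        using \<mu> by (simp add: smult_smult_assoc)
    qed
    finally show ?thesis .
  qed
  then show ?thesis
    unfolding eigenspace_def by auto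
qed

lemma embed_mat_conj_class_iff:
  fixes xi :: "'a::{field,finite}"
  assumes w: "w \<in> carrier_mat N N" and N: "N \<le> n" and k: "k \<le> N" and xi: "xi \<noteq> 0" "xi \<noteq> 1"
  shows "embed_mat n w \<in> conj_class n (diag_xi n k xi) \<longleftrightarrow> w \<in> conj_class N (diag_xi N k xi)"
proof -
  let ?q = "card (UNIV :: 'a set)"
  have "?q ^ (n - k) = ?q ^ (N - k) * ?q ^ (n - N)"
    using N k by (simp flip: power_add)
  moreover have "0 < ?q ^ (n - N)"
    by (simp add: finite_UNIV_card_ge_0)
  ultimately show ?thesis
    using w N k xi by (simp add: conj_class_diag_xi_iff card_eigenspace_embed_mat)
qed

lemma smult_inverse_conj_class:
  fixes xi :: "'a::{field,finite}"
  assumes w: "w \<in> conj_class N (diag_xi N k xi)" and v: "v \<in> carrier_mat N N" "w * v = 1\<^sub>m N" "v * w = 1\<^sub>m N"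
    and k: "k \<le> N" and xi: "xi \<noteq> 0" "xi \<noteq> 1"
  shows "xi \<cdot>\<^sub>m v \<in> conj_class N (diag_xi N (N - k) xi)"
proof -
  have wc: "w \<in> carrier_mat N N"
    using w by (rule conj_class_carrier)
  have "eigenspace N (xi \<cdot>\<^sub>m v) xi = eigenspace N w 1" "eigenspace N (xi \<cdot>\<^sub>m v) 1 = eigenspace N w xi"
    using eigenspace_smult_inverse[OF wc v xi(1), of 1] eigenspace_smult_inverse[OF wc v xi(1), of xi] xi
    by simp_all
  then show ?thesis
    using w v(1) k xi by (simp add: conj_class_diag_xi_iff)
qed

lemma factorizations_eq_image_embed_mat:
  fixes xi :: "'a::{field,finite}"
  assumes xi: "xi \<noteq> 0" "xi \<noteq> 1" and N: "c + d \<le> n"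
  shows "{x \<in> conj_class n (diag_xi n c xi). \<exists>y \<in> conj_class n (diag_xi n d xi). x * y = diag_xi n (c + d) xi}
    = embed_mat n ` conj_class (c + d) (diag_xi (c + d) c xi)"
proof (intro equalityI subsetI)
  fix x assume "x \<in> {x \<in> conj_class n (diag_xi n c xi). \<exists>y \<in> conj_class n (diag_xi n d xi). x * y = diag_xi n (c + d) xi}"
  then obtain y where x: "x \<in> conj_class n (diag_xi n c xi)" and y: "y \<in> conj_class n (diag_xi n d xi)"
    and xy: "x * y = diag_xi n (c + d) xi"
    by blast
  define w where "w = mat (c + d) (c + d) (\<lambda>(i, j). x $$ (i, j))"
  have wc: "w \<in> carrier_mat (c + d) (c + d)"
    unfolding w_def by simp
  have xw: "x = embed_mat n w"
    unfolding w_def by (rule factor_eq_embed_mat[OF x y xy xi N])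
  then have "w \<in> conj_class (c + d) (diag_xi (c + d) c xi)"
    using x embed_mat_conj_class_iff[OF wc N _ xi, of c] by simp
  then show "x \<in> embed_mat n ` conj_class (c + d) (diag_xi (c + d) c xi)"
    using xw by blast
next
  fix x assume "x \<in> embed_mat n ` conj_class (c + d) (diag_xi (c + d) c xi)"
  then obtain w where w: "w \<in> conj_class (c + d) (diag_xi (c + d) c xi)" and xw: "x = embed_mat n w"
    by blast
  have wc: "w \<in> carrier_mat (c + d) (c + d)"
    using w by (rule conj_class_carrier)
  obtain v where v: "v \<in> carrier_mat (c + d) (c + d)" "w * v = 1\<^sub>m (c + d)" "v * w = 1\<^sub>m (c + d)"
    using GL_inverseE w unfolding conj_class_def by blast
  have "xi \<cdot>\<^sub>m v \<in> conj_class (c + d) (diag_xi (c + d) d xi)"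
    using smult_inverse_conj_class[OF w v _ xi] by simp
  then have "x \<in> conj_class n (diag_xi n c xi)" "embed_mat n (xi \<cdot>\<^sub>m v) \<in> conj_class n (diag_xi n d xi)"
    using w embed_mat_conj_class_iff[OF wc N _ xi, of c] embed_mat_conj_class_iff[OF smult_carrier_mat[OF v(1)] N _ xi, of d]
    unfolding xw by simp_all
  moreover have "x * embed_mat n (xi \<cdot>\<^sub>m v) = diag_xi n (c + d) xi"
    using wc v N unfolding xw by (simp flip: embed_mat_mult add: embed_mat_smult_one mult_smult_distrib)
  ultimately show "x \<in> {x \<in> conj_class n (diag_xi n c xi). \<exists>y \<in> conj_class n (diag_xi n d xi). x * y = diag_xi n (c + d) xi}"
    by blast
qed

lemma struct_const_eq_card_pairs:
  fixes L M z :: "'a::{field,finite} mat"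
  shows "struct_const n L M z = int (card {(x, y) \<in> conj_class n L \<times> conj_class n M. x * y = z})"
proof -
  let ?A = "{(x, y). x \<in> GL n \<and> y \<in> GL n \<and> x * y = z}"
  have "?A \<subseteq> GL n \<times> GL n"
    by auto
  then have "finite ?A"
    by (rule finite_subset) simp
  have "struct_const n L M z = (\<Sum>p\<in>?A. if fst p \<in> conj_class n L \<and> snd p \<in> conj_class n M then 1 else 0)"
    unfolding struct_const_def galg_mult_def class_sum_def by (intro sum.cong) auto
  also have "\<dots> = int (card {p \<in> ?A. fst p \<in> conj_class n L \<and> snd p \<in> conj_class n M})"
    using sum.inter_filter[OF \<open>finite ?A\<close>, of "\<lambda>_. 1 :: int"] by simp
  also have "{p \<in> ?A. fst p \<in> conj_class n L \<and> snd p \<in> conj_class n M}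
      = {(x, y) \<in> conj_class n L \<times> conj_class n M. x * y = z}"
    by (auto simp: conj_class_def)
  finally show ?thesis .
qed

lemma card_factor_pairs:
  fixes L M z :: "'a::field mat"
  shows "card {(x, y) \<in> conj_class n L \<times> conj_class n M. x * y = z}
    = card {x \<in> conj_class n L. \<exists>y \<in> conj_class n M. x * y = z}"
proof -
  let ?B = "{(x, y) \<in> conj_class n L \<times> conj_class n M. x * y = z}"
  have inj: "inj_on fst ?B"
  proof (rule inj_onI)
    fix p p' assume "p \<in> ?B" "p' \<in> ?B" "fst p = fst p'"
    then obtain x y y' where p: "p = (x, y)" "p' = (x, y')" and x: "x \<in> GL n"
      and y: "y \<in> carrier_mat n n" "y' \<in> carrier_mat n n" and xy: "x * y = x * y'"
      by (cases p, cases p') (auto simp: conj_class_def intro: GL_carrier)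
    obtain u where u: "u \<in> carrier_mat n n" "u * x = 1\<^sub>m n"
      using GL_inverseE[OF x] by blast
    have "y = u * (x * y)" "y' = u * (x * y')"
      using mult_cancel_left_mat[OF u(1) GL_carrier[OF x] u(2)] y by simp_all
    then show "p = p'"
      using xy p by simp
  qed
  have "fst ` ?B = {x \<in> conj_class n L. \<exists>y \<in> conj_class n M. x * y = z}"
  proof (intro equalityI subsetI)
    fix x assume "x \<in> {x \<in> conj_class n L. \<exists>y \<in> conj_class n M. x * y = z}"
    then obtain y where "(x, y) \<in> ?B"
      by blast
    then show "x \<in> fst ` ?B"
      using image_eqI[of x fst "(x, y)"] by simp
  qed auto
  then show ?thesis
    using card_image[OF inj] by simp
qed

section \<open>Orders of general linear groups\<close>

definition GL_order :: "real \<Rightarrow> nat \<Rightarrow> real" where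
  "GL_order q m = (\<Prod>i<m. q ^ m - q ^ i)"

lemma real_card_GL:
  "real (card (GL m :: 'a::{field,finite} mat set)) = GL_order (real (card (UNIV :: 'a set))) m"
proof -
  have "card (UNIV :: 'a set) ^ i \<le> card (UNIV :: 'a set) ^ m" if "i < m" for i
    using that card_UNIV_field_ge_2[where 'a = 'a] by (intro power_increasing) auto
  then show ?thesis
    by (simp add: card_GL GL_order_def of_nat_diff)
qed

lemma GL_order_pos: "1 < q \<Longrightarrow> 0 < GL_order q m"
  unfolding GL_order_def by (intro prod_pos) (simp add: power_strict_increasing)

lemma prod_power_lessThan_add:
  "(\<Prod>i<c + d. q ^ i) = (\<Prod>i<c. q ^ i) * (\<Prod>i<d. q ^ i) * (q :: real) ^ (c * d)"
  by (induction d) (simp_all add: power_add algebra_simps)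

lemma GL_order_eq_qfact:
  assumes "q \<noteq> 1"
  shows "GL_order q m = (\<Prod>i<m. q ^ i) * (q - 1) ^ m * qfact q m"
proof -
  have "q ^ m - q ^ i = q ^ i * ((q - 1) * qnum q (m - i))" if "i < m" for i
  proof -
    have "q ^ m = q ^ i * q ^ (m - i)"
      using that by (simp flip: power_add)
    then have "q ^ m - q ^ i = q ^ i * (q ^ (m - i) - 1)"
      by (simp add: right_diff_distrib)
    also have "q ^ (m - i) - 1 = (q - 1) * qnum q (m - i)"
      using assms by (simp add: qnum_def)
    finally show ?thesis .
  qed
  then have "GL_order q m = (\<Prod>i<m. q ^ i) * (q - 1) ^ m * (\<Prod>i<m. qnum q (m - i))"
    unfolding GL_order_def by (simp add: prod.distrib)
  also have "(\<Prod>i<m. qnum q (m - i)) = (\<Prod>i<m. qnum q (Suc i))"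
    using prod.nat_diff_reindex[of "\<lambda>i. qnum q (Suc i)" m] by (simp add: Suc_diff_Suc)
  also have "\<dots> = qfact q m"
    unfolding qfact_def by (simp add: prod.atLeast1_atMost_eq)
  finally show ?thesis .
qed

lemma qfact_Suc: "qfact q (Suc m) = qfact q m * qnum q (Suc m)"
  unfolding qfact_def by (simp add: prod.cl_ivl_Suc)

lemma qfact_add: "qfact q (c + d) = qfact q d * (\<Prod>i<c. qnum q (c + d - i))"
  by (induction c) (simp_all add: qfact_Suc prod.lessThan_Suc_shift del: prod.lessThan_Suc)

lemma qfact_pos:
  assumes "1 < q"
  shows "0 < qfact q m"
proof -
  have "0 < qnum q i" if "1 \<le> i" for i
    using assms that by (simp add: qnum_def one_less_power)
  then show ?thesis
    unfolding qfact_def by (intro prod_pos) auto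
qed

lemma qbinom_mult_qfact:
  assumes "1 < q"
  shows "qbinom q (c + d) c * qfact q c * qfact q d = qfact q (c + d)"
  using qfact_pos[OF assms, of c] by (simp add: qbinom_def qfact_add)

lemma GL_order_add:
  assumes "1 < q"
  shows "GL_order q (c + d) = q ^ (c * d) * qbinom q (c + d) c * GL_order q c * GL_order q d"
proof -
  have "GL_order q (c + d) = (\<Prod>i<c + d. q ^ i) * (q - 1) ^ (c + d) * qfact q (c + d)"
    using assms by (simp add: GL_order_eq_qfact)
  also have "\<dots> = q ^ (c * d) * qbinom q (c + d) c
      * ((\<Prod>i<c. q ^ i) * (q - 1) ^ c * qfact q c) * ((\<Prod>i<d. q ^ i) * (q - 1) ^ d * qfact q d)"
    by (simp add: prod_power_lessThan_add power_add flip: qbinom_mult_qfact[OF assms])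
  also have "\<dots> = q ^ (c * d) * qbinom q (c + d) c * GL_order q c * GL_order q d"
    using assms by (simp add: GL_order_eq_qfact)
  finally show ?thesis .
qed

lemma struct_const_diag_xi:
  fixes xi :: "'a::{field,finite}"
  assumes "xi \<noteq> 0" "xi \<noteq> 1" "c + d \<le> n"
  shows "struct_const n (diag_xi n c xi) (diag_xi n d xi) (diag_xi n (c + d) xi)
    = int (card (conj_class (c + d) (diag_xi (c + d) c xi)))"
proof -
  have "inj_on (embed_mat n) (conj_class (c + d) (diag_xi (c + d) c xi))"
    using inj_on_embed_mat by (rule inj_on_subset) (auto intro: conj_class_carrier)
  then show ?thesis
    unfolding struct_const_eq_card_pairs card_factor_pairs factorizations_eq_image_embed_mat[OF assms]
    by (simp add: card_image)
qed

lemma card_conj_class_diag_xi: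
  fixes xi :: "'a::{field,finite}"
  assumes "xi \<noteq> 0" "xi \<noteq> 1"
  shows "real (card (conj_class (c + d) (diag_xi (c + d) c xi)))
    = real (card (UNIV :: 'a set)) ^ (c * d) * qbinom (real (card (UNIV :: 'a set))) (c + d) c"
proof -
  let ?Q = "real (card (UNIV :: 'a set))"
  let ?C = "conj_class (c + d) (diag_xi (c + d) c xi)"
  have Q: "1 < ?Q"
    using card_UNIV_field_ge_2[where 'a = 'a] by simp
  have "card (GL (c + d) :: 'a mat set) = card ?C * (card (GL c :: 'a mat set) * card (GL d :: 'a mat set))"
    using card_GL_eq_conj_class_centralizer[OF diag_xi_GL[OF assms(1), of "c + d" c]]
      card_centralizer_diag_xi[OF assms(2), of c d] by simp
  then have "real (card (GL (c + d) :: 'a mat set))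
      = real (card ?C) * real (card (GL c :: 'a mat set)) * real (card (GL d :: 'a mat set))"
    by simp
  then have "real (card ?C) * GL_order ?Q c * GL_order ?Q d = GL_order ?Q (c + d)"
    by (simp add: real_card_GL)
  also have "\<dots> = ?Q ^ (c * d) * qbinom ?Q (c + d) c * GL_order ?Q c * GL_order ?Q d"
    by (rule GL_order_add[OF Q])
  finally show ?thesis
    using GL_order_pos[OF Q, of c] GL_order_pos[OF Q, of d] by simp
qed

theorem proposition4p6:
  fixes xi :: "'a::{field,finite}" and c d n :: nat
  assumes "c \<ge> 1" and "d \<ge> 1"
    and "xi \<noteq> 0" and "xi \<noteq> 1"
    and "n \<ge> c + d"
  shows "real_of_int (struct_const n (diag_xi n c xi) (diag_xi n d xi) (diag_xi n (c + d) xi))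
           = real (card (UNIV :: 'a set)) ^ (c * d) * qbinom (real (card (UNIV :: 'a set))) (c + d) c"
  using struct_const_diag_xi[OF assms(3-5)] card_conj_class_diag_xi[OF assms(3,4)] by simp

end
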